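(* There exists an absolute constant $C \in (0,\infty)$ such that the following holds. Let $p$ be a prime, $n$ a positive integer, $K \geq 1$, and let $A \subseteq \mathbb{F}_p^n$ be a nonempty set with $|A - A| \leq K|A|$. Then there exists a linear subspace $V \subseteq 2A - 2A$ of $\mathbb{F}_p^n$ with $|V| \geq |A|/p^{C \log^4(Kp)}$.
   Context: $A - A = \{a - b : a,b \in A\}$ and $2A - 2A = \{a_1 + a_2 - a_3 - a_4 : a_1,a_2,a_3,a_4 \in A\}$. *)

theory Defs
  imports Complex_Main "HOL-Number_Theory.Residues"
begin

text \<open>
  The dimension and the prime must be quantified inside a formula, so they cannot be encoded in
  types. Vectors with \<open>n\<close> coordinates in \<open>R\<close> are therefore extensional functions on \<open>{..<n}\<close>.
  The ring multiplication and unit of the record are not part of the module structure.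
\<close>

definition coord_module :: "('a, 'm) ring_scheme \<Rightarrow> nat \<Rightarrow> ('a, nat \<Rightarrow> 'a) module" where
  "coord_module R n =
     \<lparr>carrier = {..<n} \<rightarrow>\<^sub>E carrier R,
      monoid.mult = undefined,
      one = undefined,
      zero = (\<lambda>i\<in>{..<n}. \<zero>\<^bsub>R\<^esub>),
      add = (\<lambda>x y. \<lambda>i\<in>{..<n}. x i \<oplus>\<^bsub>R\<^esub> y i),
      smult = (\<lambda>c x. \<lambda>i\<in>{..<n}. c \<otimes>\<^bsub>R\<^esub> x i)\<rparr>"

abbreviation Fp :: "nat \<Rightarrow> int ring" where
  "Fp p \<equiv> residue_ring (int p)"

abbreviation Fp_vec :: "nat \<Rightarrow> nat \<Rightarrow> (int, nat \<Rightarrow> int) module" where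
  "Fp_vec p n \<equiv> coord_module (Fp p) n"

definition diff_set :: "('a, 'm) ring_scheme \<Rightarrow> 'a set \<Rightarrow> 'a set" where
  "diff_set G A = {a \<ominus>\<^bsub>G\<^esub> b | a b. a \<in> A \<and> b \<in> A}"

definition double_diff_set :: "('a, 'm) ring_scheme \<Rightarrow> 'a set \<Rightarrow> 'a set" where
  "double_diff_set G A =
     {((a1 \<oplus>\<^bsub>G\<^esub> a2) \<ominus>\<^bsub>G\<^esub> a3) \<ominus>\<^bsub>G\<^esub> a4 | a1 a2 a3 a4.
        a1 \<in> A \<and> a2 \<in> A \<and> a3 \<in> A \<and> a4 \<in> A}"

lemma coord_module_module:
  assumes "cring R"
  shows "module R (coord_module R n)"
proof -
  interpret R: cring R by fact
  show ?thesis
  proof (rule moduleI)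
    show "abelian_group (coord_module R n)"
    proof (rule abelian_groupI)
      fix x assume x: "x \<in> carrier (coord_module R n)"
      show "\<exists>y\<in>carrier (coord_module R n). y \<oplus>\<^bsub>coord_module R n\<^esub> x = \<zero>\<^bsub>coord_module R n\<^esub>"
        using x
        by (intro bexI[of _ "\<lambda>i\<in>{..<n}. \<ominus>\<^bsub>R\<^esub> x i"])
           (auto simp: coord_module_def PiE_iff R.l_neg intro!: restrict_ext)
    qed (auto simp: coord_module_def PiE_iff extensional_def fun_eq_iff R.a_ac)
  qed (auto simp: coord_module_def PiE_iff extensional_def fun_eq_iff R.l_distr R.r_distr
         R.m_assoc intro: assms)
qed

lemma module_Fp_vec:
  assumes "prime p"
  shows "module (Fp p) (Fp_vec p n)"
proof -
  interpret residues "int p" "Fp p"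
    using prime_gt_1_nat[OF assms] by unfold_locales auto
  show ?thesis by (rule coord_module_module) (rule cring)
qed

lemma field_Fp:
  assumes "prime p"
  shows "field (Fp p)"
proof -
  interpret residues_prime p "Fp p"
    using assms by unfold_locales auto
  show ?thesis by (rule is_field)
qed

lemma card_Fp_vec: "card (carrier (Fp_vec p n)) = p ^ n"
  by (simp add: coord_module_def residue_ring_def card_PiE)

end

theory Submission
  imports Defs "HOL-Library.Set_Algebras" "HOL-Library.Function_Algebras"
begin

text \<open>
  Following Sanders, let \<open>H\<close> be a maximal subgroup meeting \<open>6A - 6A\<close> only in \<open>0\<close>. By Pluennecke's
  inequality \<open>A + H\<close> is dense in the whole group \<open>G\<close>, with density \<open>\<alpha> \<ge> (Kp)\<^sup>-\<^sup>1\<^sup>2\<close>, and a subspace of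
  \<open>2(A + H) - 2(A + H)\<close> is isomorphic modulo \<open>H\<close> to one of \<open>2A - 2A\<close>.

  For dense \<open>A\<close>, the function \<open>F\<close> averaging the indicator of \<open>A - A\<close> over the translates by \<open>A\<close>
  equals \<open>1\<close> on \<open>-A\<close>. By Croot and Sisask, random sampling of \<open>F\<close> gives a set \<open>T\<close> of
  density \<open>exp (-O(log\<^sup>4 (1/\<alpha>)))\<close> such that \<open>F\<close> remains close to \<open>1\<close> on average over \<open>-A\<close> after
  \<open>l = O(log (1/\<alpha>))\<close> averagings over \<open>T - T\<close>. By Chang's theorem the characters with a large mean on \<open>T\<close>
  are trivial on a subspace \<open>V\<close> of codimension \<open>O(log\<^sup>4 (1/\<alpha>))\<close>; the averagings make the other
  characters negligible, so a further average over \<open>V\<close> still is close to \<open>1\<close>. Hence \<open>A - A\<close> contains more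
  than half of a coset of \<open>V\<close>, so that \<open>V \<subseteq> 2A - 2A\<close>.
\<close>

section \<open>Sumset inequalities\<close>

lemma card_Un_diff_image:
  fixes c :: "'a::ab_group_add"
  assumes "finite S" "finite R" "R' \<subseteq> R" "(+) c ` R' \<subseteq> S"
  shows "card (S \<union> (+) c ` R) + card R' \<le> card S + card R"
proof -
  have fR': "finite R'" using assms finite_subset by blast
  have "S \<union> (+) c ` R = S \<union> (+) c ` (R - R')" using assms(3,4) by blast
  then have "card (S \<union> (+) c ` R) \<le> card S + card ((+) c ` (R - R'))"
    by (simp add: card_Un_le)
  also have "card ((+) c ` (R - R')) = card (R - R')"
    by (intro card_image) (auto simp: inj_on_def)
  also have "\<dots> = card R - card R'" using assms(3) fR' by (simp add: card_Diff_subset)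
  finally show ?thesis using card_mono[OF assms(2,3)] by linarith
qed

text \<open>Petridis's lemma, by adding the elements of \<open>C\<close> one at a time. Passing to
  \<open>insert c C\<close> enlarges \<open>X + B + C\<close> by at most the part of
  \<open>c + (X + B)\<close> outside \<open>c + (Z + B)\<close>, where \<open>Z\<close> collects the
  \<open>x\<close> with \<open>c + x + B\<close> already covered, and minimality bounds
  \<open>card (Z + B)\<close> below by \<open>k * card Z\<close>. Meanwhile \<open>X + C\<close>
  gains exactly \<open>card X - card W\<close> elements, which is enough since
  \<open>W \<subseteq> Z\<close>.\<close>

lemma petridis:
  fixes X B C :: "'a::ab_group_add set" and k :: real
  assumes fin: "finite X" "finite B" and k: "k * card X = card (X + B)"
    and min: "\<And>Z. Z \<subseteq> X \<Longrightarrow> Z \<noteq> {} \<Longrightarrow> k * card Z \<le> card (Z + B)"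
    and "finite C" and k0: "k \<ge> 0"
  shows "card (X + B + C) \<le> k * card (X + C)"
  using \<open>finite C\<close>
proof (induction C rule: finite_induct)
  case empty
  then show ?case by (simp add: set_plus_def)
next
  case (insert c C)
  define Z where "Z = {x \<in> X. (+) c ` ({x} + B) \<subseteq> X + B + C}"
  define W where "W = {x \<in> X. c + x \<in> X + C}"
  have fins: "finite (X + B)" "finite (X + B + C)" "finite (X + C)" "finite Z" "finite W"
    using fin insert.hyps by (auto simp: Z_def W_def intro!: finite_set_plus)
  have WZ: "W \<subseteq> Z"
  proof
    fix x assume x: "x \<in> W"
    then obtain x' c' where x': "x' \<in> X" "c' \<in> C" "c + x = x' + c'"
      by (auto simp: W_def elim!: set_plus_elim)
    have "c + (x + b) \<in> X + B + C" if "b \<in> B" for b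
    proof -
      have eq: "c + (x + b) = x' + b + c'" using x'(3) by (simp add: algebra_simps)
      show ?thesis unfolding eq by (intro set_plus_intro x' that)
    qed
    then show "x \<in> Z" using x by (auto simp: Z_def W_def elim!: set_plus_elim)
  qed
  have ZX: "Z \<subseteq> X" by (auto simp: Z_def)
  have kZ: "k * card Z \<le> card (Z + B)"
    using min[OF ZX] by (cases "Z = {}") auto
  have "X + B + insert c C = X + B + C \<union> (+) c ` (X + B)"
    by (force simp: set_plus_def add.commute)
  moreover have "(+) c ` (Z + B) \<subseteq> X + B + C"
  proof (clarsimp elim!: set_plus_elim)
    fix z b assume "z \<in> Z" "b \<in> B"
    then show "c + (z + b) \<in> X + B + C" by (auto simp: Z_def image_subset_iff)
  qed
  moreover have "Z + B \<subseteq> X + B" using ZX by (rule set_plus_mono2) simp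
  ultimately have "card (X + B + insert c C) + card (Z + B) \<le> card (X + B + C) + card (X + B)"
    using card_Un_diff_image[OF fins(2,1)] by simp
  then have 1: "real (card (X + B + insert c C)) \<le> k * card (X + C) + k * card X - k * card Z"
    using insert.IH kZ k by linarith
  have "X + insert c C = X + C \<union> (+) c ` X"
    by (force simp: set_plus_def add.commute)
  also have "\<dots> = X + C \<union> (+) c ` (X - W)" by (auto simp: W_def)
  finally have "X + insert c C = X + C \<union> (+) c ` (X - W)" .
  moreover have "(X + C) \<inter> (+) c ` (X - W) = {}" by (auto simp: W_def)
  ultimately have "card (X + insert c C) = card (X + C) + card ((+) c ` (X - W))"
    using fin fins by (simp add: card_Un_disjoint)
  moreover have "card ((+) c ` (X - W)) = card (X - W)"
    by (intro card_image) (auto simp: inj_on_def)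
  moreover have "W \<subseteq> X" by (auto simp: W_def)
  ultimately have "real (card (X + insert c C)) = card (X + C) + real (card X) - real (card W)"
    using fin fins card_mono[of X W] by (simp add: card_Diff_subset)
  moreover have "real (card W) \<le> real (card Z)" using WZ fins by (simp add: card_mono)
  ultimately have "k * (card (X + C) + real (card X) - real (card Z)) \<le> k * card (X + insert c C)"
    using k0 by (intro mult_left_mono) auto
  then show ?case using 1 by (simp add: algebra_simps)
qed

text \<open>Fix one representation \<open>d = u d - w d\<close> of each difference. The map
  \<open>(x, d) \<mapsto> (x + u d, x + w d)\<close> is injective because the difference of the two
  components gives back \<open>d\<close>, and then \<open>x\<close>.\<close>

lemma ruzsa_triangle:
  fixes X U W :: "'a::ab_group_add set"
  assumes "finite X" "finite U" "finite W"
  shows "card X * card (U + uminus ` W) \<le> card (X + U) * card (X + W)"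
proof -
  define D where "D = U + uminus ` W"
  have "\<forall>d\<in>D. \<exists>u w. u \<in> U \<and> w \<in> W \<and> d = u - w"
    by (auto simp: D_def set_plus_def)
  then obtain u w where uw: "\<And>d. d \<in> D \<Longrightarrow> u d \<in> U \<and> w d \<in> W \<and> d = u d - w d"
    by metis
  let ?f = "\<lambda>(x, d). (x + u d, x + w d)"
  have inj: "inj_on ?f (X \<times> D)"
  proof (rule inj_onI, clarify)
    fix x d x' d' assume *: "d \<in> D" "d' \<in> D" "x + u d = x' + u d'" "x + w d = x' + w d'"
    have "d = (x + u d) - (x + w d)" using uw[OF *(1)] by (simp add: algebra_simps)
    also have "\<dots> = d'" using uw[OF *(2)] by (simp add: * algebra_simps)
    finally show "x = x' \<and> d = d'" using * by simp
  qed
  have "?f ` (X \<times> D) \<subseteq> (X + U) \<times> (X + W)" using uw by (auto intro!: set_plus_intro)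
  then have "card (X \<times> D) \<le> card ((X + U) \<times> (X + W))"
    using assms by (intro card_inj_on_le[OF inj]) (auto intro!: finite_set_plus finite_cartesian_product)
  then show ?thesis by (simp add: D_def card_cartesian_product)
qed

text \<open>Used at two types: on group elements it is the \<open>k\<close>-fold multiple, and on
  sets, with addition lifted pointwise, the \<open>k\<close>-fold sumset. The class
  \<open>comm_monoid_add\<close> covers both.\<close>

definition nmult :: "nat \<Rightarrow> 'a::comm_monoid_add \<Rightarrow> 'a" where
  "nmult k x = (\<Sum>i<k. x)"

lemma nmult_0 [simp]: "nmult 0 x = 0"
  and nmult_Suc [simp]: "nmult (Suc k) x = nmult k x + x"
  by (simp_all add: nmult_def)

lemma nmult_zero [simp]: "nmult k 0 = 0"
  by (simp add: nmult_def)

lemma nmult_distrib: "nmult k (x + y) = nmult k x + nmult k y"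
  by (simp add: nmult_def sum.distrib)

lemma nmult_add: "nmult (j + k) x = nmult j x + nmult k x"
  by (induction k) (simp_all add: add_ac)

lemma nmult_mult: "nmult (j * k) x = nmult j (nmult k x)"
  by (induction j) (simp_all add: nmult_add add_ac)

lemma finite_nmult_set: "finite B \<Longrightarrow> finite (nmult n B)"
  by (induction n) (auto intro: finite_set_plus)

lemma uminus_image_plus:
  fixes A B :: "'a::ab_group_add set"
  shows "uminus ` (A + B) = uminus ` A + uminus ` B"
  by (force simp: set_plus_def image_iff)

lemma uminus_image_nmult:
  fixes A :: "'a::ab_group_add set"
  shows "uminus ` nmult n A = nmult n (uminus ` A)"
  by (induction n) (simp_all add: uminus_image_plus)

text \<open>With \<open>B = - A\<close>, a nonempty \<open>X \<subseteq> A\<close> minimising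
  \<open>card (X + B) / card X\<close> satisfies the hypotheses of \<open>petridis\<close> with some
  \<open>k \<le> K\<close>. Iteration bounds \<open>X + nmult n B\<close> by
  \<open>k ^ n * card X\<close>, and the Ruzsa triangle inequality, with \<open>nmult n B\<close> in
  both places, passes to the difference set of \<open>nmult n B\<close>.\<close>

lemma plunnecke:
  fixes A :: "'a::ab_group_add set" and K :: real
  assumes "finite A" "A \<noteq> {}" and small: "card (A + uminus ` A) \<le> K * card A"
  shows "card (nmult n (A + uminus ` A)) \<le> K ^ (2 * n) * card A"
proof -
  define B where "B = uminus ` A"
  have fB: "finite B" using assms by (simp add: B_def)
  define r where "r X = card (X + B) / card X" for X
  define X where "X = arg_min_on r (Pow A - {{}})"
  have Xin: "X \<in> Pow A - {{}}" unfolding X_def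
    using assms by (intro arg_min_if_finite) auto
  have Xmin: "r X \<le> r Y" if "Y \<in> Pow A - {{}}" for Y
    unfolding X_def using assms that by (intro arg_min_least) auto
  have X: "X \<subseteq> A" "X \<noteq> {}" "finite X" using Xin assms finite_subset by auto
  have cX: "card X > 0" using X by (simp add: card_gt_0_iff)
  have cA: "card A > 0" using assms by (simp add: card_gt_0_iff)
  define k where "k = r X"
  have "k \<le> r A" unfolding k_def using assms by (intro Xmin) auto
  also have "\<dots> \<le> K" using small cA by (simp add: r_def B_def divide_simps)
  finally have kK: "k \<le> K" .
  have k0: "k \<ge> 0" by (simp add: k_def r_def)
  have pet: "card (X + B + C) \<le> k * card (X + C)" if "finite C" for C
  proof (rule petridis[OF X(3) fB _ _ that k0])
    show "k * card X = card (X + B)" using cX by (simp add: k_def r_def)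
    fix Z assume Z: "Z \<subseteq> X" "Z \<noteq> {}"
    then have "k \<le> r Z" unfolding k_def using X by (intro Xmin) auto
    moreover have "card Z > 0" using Z X finite_subset by (metis card_gt_0_iff)
    ultimately show "k * card Z \<le> card (Z + B)" by (simp add: r_def field_simps)
  qed
  have iter: "card (X + nmult n B) \<le> k ^ n * card X" for n
  proof (induction n)
    case (Suc n)
    have "X + nmult (Suc n) B = X + B + nmult n B" by (simp add: add_ac)
    then have "card (X + nmult (Suc n) B) \<le> k * card (X + nmult n B)"
      using pet[OF finite_nmult_set[OF fB]] by simp
    also have "\<dots> \<le> k * (k ^ n * card X)" using Suc k0 by (intro mult_left_mono)
    finally show ?case by simp
  qed simp
  have "nmult n (A + uminus ` A) = nmult n B + uminus ` nmult n B"
    by (simp add: nmult_distrib uminus_image_nmult B_def image_image add.commute)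
  then have "card X * card (nmult n (A + uminus ` A)) \<le> card (X + nmult n B) * card (X + nmult n B)"
    using ruzsa_triangle[of X "nmult n B" "nmult n B"] X(3) finite_nmult_set[OF fB] by simp
  then have "real (card X) * card (nmult n (A + uminus ` A))
      \<le> real (card (X + nmult n B)) * card (X + nmult n B)"
    by (metis of_nat_le_iff of_nat_mult)
  also have "\<dots> \<le> (k ^ n * card X) * (k ^ n * card X)"
    using iter k0 by (intro mult_mono) auto
  finally have "card (nmult n (A + uminus ` A)) \<le> k ^ n * k ^ n * card X"
    using cX by (simp add: field_simps)
  also have "\<dots> = k ^ (2 * n) * card X" by (simp add: power_add mult_2)
  also have "\<dots> \<le> K ^ (2 * n) * card A"
    using kK k0 X assms by (intro mult_mono power_mono) (auto simp: card_mono)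
  finally show ?thesis .
qed

section \<open>Characters and Chang's theorem\<close>

definition add_subgroup :: "'g::ab_group_add set \<Rightarrow> bool" where
  "add_subgroup H \<longleftrightarrow> 0 \<in> H \<and> (\<forall>x\<in>H. \<forall>y\<in>H. x - y \<in> H)"

lemma add_subgroup_zero: "add_subgroup H \<Longrightarrow> 0 \<in> H"
  and add_subgroup_diff: "add_subgroup H \<Longrightarrow> x \<in> H \<Longrightarrow> y \<in> H \<Longrightarrow> x - y \<in> H"
  by (auto simp: add_subgroup_def)

lemma add_subgroup_uminus: "add_subgroup H \<Longrightarrow> x \<in> H \<Longrightarrow> - x \<in> H"
  by (metis add_subgroup_def diff_0)

lemma add_subgroup_add: "add_subgroup H \<Longrightarrow> x \<in> H \<Longrightarrow> y \<in> H \<Longrightarrow> x + y \<in> H"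
  by (metis add_subgroup_diff add_subgroup_uminus diff_minus_eq_add)

lemmas add_subgroup_closed =
  add_subgroup_zero add_subgroup_diff add_subgroup_uminus add_subgroup_add

lemma sum_translate:
  assumes "add_subgroup G" "v \<in> G"
  shows "(\<Sum>x\<in>G. f (x + v)) = (\<Sum>x\<in>G. f x)"
  by (rule sum.reindex_bij_witness[of _ "\<lambda>x. x - v" "\<lambda>x. x + v"])
     (use assms in \<open>auto intro: add_subgroup_closed\<close>)

definition character :: "'g::ab_group_add set \<Rightarrow> ('g \<Rightarrow> complex) \<Rightarrow> bool" where
  "character G \<chi> \<longleftrightarrow> (\<forall>x\<in>G. \<forall>y\<in>G. \<chi> (x + y) = \<chi> x * \<chi> y) \<and> (\<forall>x\<in>G. norm (\<chi> x) = 1)"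

lemma character_add: "character G \<chi> \<Longrightarrow> x \<in> G \<Longrightarrow> y \<in> G \<Longrightarrow> \<chi> (x + y) = \<chi> x * \<chi> y"
  and character_norm: "character G \<chi> \<Longrightarrow> x \<in> G \<Longrightarrow> norm (\<chi> x) = 1"
  by (auto simp: character_def)

lemma character_diff:
  assumes "character G \<chi>" "add_subgroup G" "x \<in> G" "y \<in> G"
  shows "\<chi> (x - y) = \<chi> x * cnj (\<chi> y)"
proof -
  have "\<chi> x = \<chi> (x - y) * \<chi> y"
    using character_add[OF assms(1) add_subgroup_diff[OF assms(2-4)] assms(4)] by simp
  moreover have "\<chi> y * cnj (\<chi> y) = 1"
    using character_norm[OF assms(1,4)] by (simp add: complex_norm_square[symmetric])
  ultimately show ?thesis by (simp add: mult.assoc)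
qed

lemma character_zero:
  assumes "character G \<chi>" "add_subgroup G"
  shows "\<chi> 0 = 1"
  using character_diff[OF assms, of 0 0] add_subgroup_zero[OF assms(2)] character_norm[OF assms(1), of 0]
  by (simp add: complex_norm_square[symmetric])

lemma character_subset: "character G \<chi> \<Longrightarrow> V \<subseteq> G \<Longrightarrow> character V \<chi>"
  by (auto simp: character_def)

lemma sum_character_eq_0:
  assumes "character V \<chi>" "add_subgroup V" "v \<in> V" "\<chi> v \<noteq> 1"
  shows "(\<Sum>x\<in>V. \<chi> x) = 0"
proof -
  have "(\<Sum>x\<in>V. \<chi> x) = (\<Sum>x\<in>V. \<chi> (x + v))" using sum_translate[OF assms(2,3), of \<chi>] by simp
  also have "\<dots> = (\<Sum>x\<in>V. \<chi> x) * \<chi> v"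
    unfolding sum_distrib_right using assms by (intro sum.cong refl) (auto simp: character_add)
  finally show ?thesis using assms(4) by auto
qed

lemma add_subgroup_kernel:
  assumes "character V \<chi>" "add_subgroup V"
  shows "add_subgroup {v \<in> V. \<chi> v = 1}"
  using assms by (auto simp: add_subgroup_def character_diff character_zero)

text \<open>The values of \<open>\<chi>\<close> are roots of unity of order dividing
  \<open>p\<close>, so there are at most \<open>p\<close> fibres, and each fibre is translated
  injectively into the kernel.\<close>

lemma card_le_kernel:
  assumes \<chi>: "character V \<chi>" and V: "add_subgroup V" "finite V"
    and p: "p > 0" "\<And>x. x \<in> V \<Longrightarrow> \<chi> x ^ p = 1"
  shows "card V \<le> p * card {v \<in> V. \<chi> v = 1}"
proof -
  have fibre: "card {v \<in> V. \<chi> v = z} \<le> card {v \<in> V. \<chi> v = 1}" if "z \<in> \<chi> ` V" for z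
  proof -
    from that obtain w where w: "w \<in> V" "z = \<chi> w" by auto
    have "\<chi> w * cnj (\<chi> w) = 1"
      using character_norm[OF \<chi> w(1)] by (simp add: complex_norm_square[symmetric])
    then show ?thesis using w V
      by (intro card_inj_on_le[where f = "\<lambda>v. v - w"])
         (auto simp: inj_on_def character_diff[OF \<chi>] intro: add_subgroup_closed)
  qed
  have "V = (\<Union>z\<in>\<chi> ` V. {v \<in> V. \<chi> v = z})" by auto
  then have "card V = card (\<Union>z\<in>\<chi> ` V. {v \<in> V. \<chi> v = z})" by simp
  also have "\<dots> \<le> (\<Sum>z\<in>\<chi> ` V. card {v \<in> V. \<chi> v = z})" using V by (intro card_UN_le) auto
  also have "\<dots> \<le> card (\<chi> ` V) * card {v \<in> V. \<chi> v = 1}"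
    using sum_bounded_above[OF fibre, of "\<chi> ` V"] by simp
  also have "card (\<chi> ` V) \<le> card {z::complex. z ^ p = 1}"
    using p by (intro card_mono) (auto intro: finite_roots_unity)
  also have "\<dots> = p" using p by (simp add: card_roots_unity_eq)
  finally show ?thesis by simp
qed

section \<open>Exponential moments and the greedy argument for Chang's theorem\<close>

lemma exp_le_quadratic:
  fixes u :: real
  assumes "\<bar>u\<bar> \<le> 1"
  shows "exp u \<le> 1 + u + u\<^sup>2"
proof (cases "u \<ge> 0")
  case True
  then show ?thesis using exp_bound[of u] assms by simp
next
  case False
  define w where "w = - u"
  have w: "0 < w" "w \<le> 1" using False assms by (auto simp: w_def)
  have "1 \<le> 1 + w ^ 3" using w by simp
  also have "\<dots> = (1 - w + w\<^sup>2) * (1 + w)" by (simp add: power2_eq_square power3_eq_cube algebra_simps)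
  also have "\<dots> \<le> (1 - w + w\<^sup>2) * exp w"
    using w by (intro mult_left_mono) (auto simp: exp_ge_add_one_self)
  finally have "exp (- w) \<le> 1 - w + w\<^sup>2" by (simp add: exp_minus divide_simps)
  then show ?thesis by (simp add: w_def)
qed

text \<open>Jensen's inequality, from the tangent to \<open>exp\<close> at \<open>m\<close>; the
  tangent is increasing, so a lower bound for the mean of \<open>g\<close> suffices.\<close>

lemma sum_exp_ge:
  fixes g :: "'a \<Rightarrow> real" and m :: real
  assumes "(\<Sum>x\<in>T. g x) \<ge> m * card T"
  shows "(\<Sum>x\<in>T. exp (g x)) \<ge> exp m * card T"
proof -
  have "exp m * card T \<le> exp m * (card T + (\<Sum>x\<in>T. g x) - m * card T)"
    using assms by (intro mult_left_mono) auto
  also have "\<dots> = (\<Sum>x\<in>T. exp m * (1 + (g x - m)))"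
    by (simp add: sum_distrib_left sum.distrib sum_subtractf algebra_simps)
  also have "\<dots> \<le> (\<Sum>x\<in>T. exp m * exp (g x - m))"
    by (intro sum_mono mult_left_mono exp_ge_add_one_self) auto
  finally show ?thesis by (simp add: exp_add[symmetric])
qed

text \<open>
  Invariant of the greedy construction behind Chang's theorem: \<open>V\<close> is the common kernel of \<open>d\<close>
  characters, and \<open>g\<close> is the sum of their real parts, each rotated so as to have a large mean on \<open>T\<close>.
\<close>

definition greedy_state ::
  "'g::ab_group_add set \<Rightarrow> 'g set \<Rightarrow> nat \<Rightarrow> nat \<Rightarrow> 'g set \<Rightarrow> ('g \<Rightarrow> real) \<Rightarrow> bool" where
  "greedy_state G T p d V g \<longleftrightarrow> add_subgroup V \<and> V \<subseteq> G \<and> card G \<le> p ^ d * card V \<and>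
     (\<forall>x\<in>G. \<forall>v\<in>V. g (x + v) = g x) \<and> (\<Sum>x\<in>G. exp (g x / 4)) \<le> exp (d / 16) * card G \<and>
     d / 2 * card T \<le> (\<Sum>x\<in>T. g x)"

text \<open>A character nontrivial on \<open>V\<close> has mean zero on every coset of
  \<open>V\<close>, while \<open>g\<close> is constant there. So the new term \<open>u\<close>
  raises the exponential sum over \<open>G\<close> only to second order, by the factor
  \<open>exp (1 / 16)\<close>, but adds at least \<open>card T / 2\<close> to the sum over
  \<open>T\<close>. Replacing \<open>V\<close> by the kernel of \<open>\<chi>\<close> on it restores
  the invariance at the cost of a factor \<open>p\<close> in the index.\<close>

lemma greedy_state_step:
  assumes st: "greedy_state G T p d V g" and G: "finite G" "add_subgroup G"
    and T: "T \<subseteq> G" "T \<noteq> {}" and p: "p > 0"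
    and \<chi>: "character G \<chi>" "\<And>x. x \<in> G \<Longrightarrow> \<chi> x ^ p = 1"
    and large: "norm (\<Sum>x\<in>T. \<chi> x) \<ge> card T / 2" and w: "w \<in> V" "\<chi> w \<noteq> 1"
  shows "\<exists>V' g'. greedy_state G T p (Suc d) V' g'"
proof -
  have V: "add_subgroup V" "V \<subseteq> G" "card G \<le> p ^ d * card V"
    and gV: "\<And>x v. x \<in> G \<Longrightarrow> v \<in> V \<Longrightarrow> g (x + v) = g x"
    and gG: "(\<Sum>x\<in>G. exp (g x / 4)) \<le> exp (d / 16) * card G"
    and gT: "d / 2 * card T \<le> (\<Sum>x\<in>T. g x)"
    using st by (auto simp: greedy_state_def)
  have fV: "finite V" using V G finite_subset by blast
  have cV: "card V > 0" using w fV by (auto simp: card_gt_0_iff)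
  have \<chi>V: "character V \<chi>" using \<chi> V by (rule_tac character_subset)
  define S where "S = (\<Sum>x\<in>T. \<chi> x)"
  have "card T > 0" using T G finite_subset by (metis card_gt_0_iff)
  then have S0: "S \<noteq> 0" using large unfolding S_def by auto
  \<comment> \<open>The rotation taking \<open>S\<close> to the positive real axis, so that
    \<open>u\<close> sums to \<open>norm S\<close> over \<open>T\<close>.\<close>
  define c where "c = cnj S / norm S"
  have c1: "norm c = 1" using S0 by (simp add: c_def norm_divide)
  have "c * S = norm S"
    using S0 complex_norm_square[of S] by (simp add: c_def field_simps power2_eq_square)
  then have cS: "Re (c * S) = norm S" by simp
  define u where "u x = Re (c * \<chi> x)" for x
  have u1: "\<bar>u x\<bar> \<le> 1" if "x \<in> G" for x
    using abs_Re_le_cmod[of "c * \<chi> x"] character_norm[OF \<chi>(1) that] c1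
    by (simp add: u_def norm_mult)
  have usum: "(\<Sum>v\<in>V. u (x + v)) = 0" if "x \<in> G" for x
  proof -
    have "(\<Sum>v\<in>V. u (x + v)) = Re (c * \<chi> x * (\<Sum>v\<in>V. \<chi> v))"
      unfolding u_def sum_distrib_left Re_sum
      using V by (intro sum.cong refl arg_cong[where f = Re])
                 (auto simp: character_add[OF \<chi>(1) that] mult.assoc)
    then show ?thesis using sum_character_eq_0[OF \<chi>V V(1) w] by simp
  qed
  have avg: "(\<Sum>v\<in>V. exp (u (x + v) / 4)) \<le> card V * exp (1 / 16)" if x: "x \<in> G" for x
  proof -
    have "(\<Sum>v\<in>V. exp (u (x + v) / 4)) \<le> (\<Sum>v\<in>V. 1 + u (x + v) / 4 + 1 / 16)"
    proof (rule sum_mono)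
      fix v assume "v \<in> V"
      then have b: "\<bar>u (x + v)\<bar> \<le> 1" using V x G by (intro u1 add_subgroup_add) auto
      then have "(u (x + v))\<^sup>2 \<le> 1" using abs_square_le_1 by blast
      then show "exp (u (x + v) / 4) \<le> 1 + u (x + v) / 4 + 1 / 16"
        using exp_le_quadratic[of "u (x + v) / 4"] b by (simp add: power_divide)
    qed
    also have "\<dots> = card V * (1 + 1 / 16)"
      using usum[OF x] by (simp add: sum.distrib sum_divide_distrib[symmetric])
    also have "\<dots> \<le> card V * exp (1 / 16)"
      by (intro mult_left_mono exp_ge_add_one_self) auto
    finally show ?thesis .
  qed
  define g' where "g' x = g x + u x" for x
  define V' where "V' = {v \<in> V. \<chi> v = 1}"
  \<comment> \<open>Translation by \<open>v \<in> V\<close> does not change a sum over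
    \<open>G\<close>. Averaging over all \<open>v\<close> leaves \<open>g\<close> fixed and replaces
    the factor from \<open>u\<close> by its coset average, bounded in \<open>avg\<close>.\<close>
  have "card V * (\<Sum>x\<in>G. exp (g' x / 4)) = (\<Sum>v\<in>V. \<Sum>x\<in>G. exp (g' (x + v) / 4))"
    using V by (subst sum.cong[OF refl sum_translate[OF G(2)]]) auto
  also have "\<dots> = (\<Sum>x\<in>G. exp (g x / 4) * (\<Sum>v\<in>V. exp (u (x + v) / 4)))"
    unfolding sum_distrib_left
    by (subst sum.swap) (auto intro!: sum.cong simp: g'_def gV add_divide_distrib exp_add)
  also have "\<dots> \<le> (\<Sum>x\<in>G. exp (g x / 4) * (card V * exp (1 / 16)))"
    by (intro sum_mono mult_left_mono avg) auto
  also have "\<dots> = (\<Sum>x\<in>G. exp (g x / 4)) * (card V * exp (1 / 16))"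
    by (simp add: sum_distrib_right)
  also have "\<dots> \<le> exp (d / 16) * card G * (card V * exp (1 / 16))"
    by (intro mult_right_mono gG) auto
  finally have "(\<Sum>x\<in>G. exp (g' x / 4)) \<le> exp (d / 16) * exp (1 / 16) * card G"
    using cV by (simp add: field_simps)
  also have "exp (d / 16) * exp (1 / 16) = exp (Suc d / 16 :: real)"
    by (simp add: exp_add[symmetric] add_divide_distrib)
  finally have 1: "(\<Sum>x\<in>G. exp (g' x / 4)) \<le> exp (Suc d / 16) * card G" .
  have "(\<Sum>x\<in>T. u x) = norm S"
    unfolding cS[symmetric] by (simp add: u_def S_def sum_distrib_left)
  then have 2: "Suc d / 2 * card T \<le> (\<Sum>x\<in>T. g' x)"
    using gT large by (simp add: g'_def sum.distrib S_def algebra_simps add_divide_distrib)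
  have "card V \<le> p * card V'"
    unfolding V'_def using V \<chi> p by (intro card_le_kernel[OF \<chi>V V(1) fV]) auto
  then have "p ^ d * card V \<le> p ^ d * (p * card V')" by (intro mult_left_mono) auto
  then have 3: "card G \<le> p ^ Suc d * card V'" using V(3) by (simp only: power_Suc mult_ac order_trans)
  have 4: "g' (x + v) = g' x" if "x \<in> G" "v \<in> V'" for x v
  proof -
    have "v \<in> V" "v \<in> G" "\<chi> v = 1" using that V by (auto simp: V'_def)
    then show ?thesis using that(1) gV by (simp add: g'_def u_def character_add[OF \<chi>(1)])
  qed
  have "add_subgroup V'" unfolding V'_def by (rule add_subgroup_kernel[OF \<chi>V V(1)])
  moreover have "V' \<subseteq> G" using V by (auto simp: V'_def)
  ultimately have "greedy_state G T p (Suc d) V' g'"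
    unfolding greedy_state_def using 1 2 3 4 by blast
  then show ?thesis by blast
qed

text \<open>By Jensen's inequality \<open>T\<close> alone contributes
  \<open>exp (d / 8) * card T\<close> to the exponential sum, whose total is at most
  \<open>exp (d / 16) * card G\<close>.\<close>

lemma greedy_state_bound:
  assumes st: "greedy_state G T p d V g" and G: "finite G" and T: "T \<subseteq> G" "T \<noteq> {}"
  shows "d \<le> 16 * ln (card G / card T)"
proof -
  have cT: "card T > 0" using T G finite_subset by (metis card_gt_0_iff)
  then have cG: "card G > 0" using T G card_mono by fastforce
  have "d / 8 * card T \<le> (\<Sum>x\<in>T. g x / 4)"
    using st by (simp add: greedy_state_def sum_divide_distrib[symmetric])
  then have "exp (d / 8) * card T \<le> (\<Sum>x\<in>T. exp (g x / 4))" by (rule sum_exp_ge)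
  also have "\<dots> \<le> (\<Sum>x\<in>G. exp (g x / 4))" using T G by (intro sum_mono2) auto
  also have "\<dots> \<le> exp (d / 16) * card G" using st by (simp add: greedy_state_def)
  finally have "exp (d / 16) * exp (d / 16) * card T \<le> exp (d / 16) * card G"
    by (simp add: exp_add[symmetric])
  then have "exp (d / 16) \<le> card G / card T" using cT by (simp add: field_simps)
  then have "d / 16 \<le> ln (card G / card T)" using cT cG by (subst ln_ge_iff) auto
  then show ?thesis by simp
qed

text \<open>A state with maximal \<open>d\<close> exists by \<open>greedy_state_bound\<close>. A
  character of \<open>X\<close> with large mean on \<open>T\<close> that is nontrivial on its
  \<open>V\<close> would allow another \<open>greedy_state_step\<close>.\<close>

theorem chang:
  fixes G T :: "'g::ab_group_add set"
  assumes G: "finite G" "add_subgroup G" and T: "T \<subseteq> G" "T \<noteq> {}" and p: "p > 0"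
    and X: "\<forall>\<chi>\<in>X. character G \<chi> \<and> (\<forall>x\<in>G. \<chi> x ^ p = 1)"
  obtains V d where "add_subgroup V" "V \<subseteq> G" "card G \<le> p ^ d * card V"
    "d \<le> 16 * ln (card G / card T)"
    "\<forall>\<chi>\<in>X. norm (\<Sum>x\<in>T. \<chi> x) \<ge> card T / 2 \<longrightarrow> (\<forall>v\<in>V. \<chi> v = 1)"
proof -
  define P where "P d \<longleftrightarrow> (\<exists>V g. greedy_state G T p d V g)" for d
  have "greedy_state G T p 0 G (\<lambda>_. 0)" using G by (simp add: greedy_state_def)
  then have P0: "P 0" by (auto simp: P_def)
  have bound: "d \<le> nat \<lfloor>16 * ln (card G / card T)\<rfloor>" if "P d" for d
  proof -
    have "d \<le> 16 * ln (card G / card T)"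
      using that greedy_state_bound[OF _ G(1) T] by (auto simp: P_def)
    then show ?thesis by (simp add: le_nat_iff le_floor_iff)
  qed
  define d where "d = (GREATEST d. P d)"
  have Pd: "P d" unfolding d_def by (rule GreatestI_nat[where P = P, OF P0 bound])
  have nP: "\<not> P (Suc d)"
    using Greatest_le_nat[where P = P, OF _ bound, of "Suc d"] unfolding d_def[symmetric] by auto
  from Pd obtain V g where st: "greedy_state G T p d V g" by (auto simp: P_def)
  show ?thesis
  proof (rule that)
    show "add_subgroup V" "V \<subseteq> G" "card G \<le> p ^ d * card V" using st by (auto simp: greedy_state_def)
    show "d \<le> 16 * ln (card G / card T)" by (rule greedy_state_bound[OF st G(1) T])
    show "\<forall>\<chi>\<in>X. norm (\<Sum>x\<in>T. \<chi> x) \<ge> card T / 2 \<longrightarrow> (\<forall>v\<in>V. \<chi> v = 1)"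
    proof (intro ballI impI)
      fix \<chi> v assume *: "\<chi> \<in> X" "norm (\<Sum>x\<in>T. \<chi> x) \<ge> card T / 2" "v \<in> V"
      show "\<chi> v = 1"
        using greedy_state_step[OF st G T p _ _ *(2,3)] X *(1) nP unfolding P_def by blast
    qed
  qed
qed

section \<open>Almost periodicity\<close>

text \<open>The convolution of \<open>f\<close> with the uniform probability measure on
  \<open>- A\<close>.\<close>

definition shift_avg :: "'g::ab_group_add set \<Rightarrow> ('g \<Rightarrow> real) \<Rightarrow> 'g \<Rightarrow> real" where
  "shift_avg A f x = (\<Sum>a\<in>A. f (x + a)) / card A"

lemma shift_avg_nonneg: "(\<And>y. f y \<ge> 0) \<Longrightarrow> shift_avg A f x \<ge> 0"
  by (simp add: shift_avg_def sum_nonneg)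

lemma shift_avg_le_1:
  assumes "\<And>y. f y \<le> 1" "finite A"
  shows "shift_avg A f x \<le> 1"
  using sum_bounded_above[of A "\<lambda>a. f (x + a)" 1] assms
  by (cases "A = {}") (auto simp: shift_avg_def divide_simps card_gt_0_iff)

text \<open>Chernoff's bound, with uniform random samples expressed by counting
  \<open>k\<close>-tuples. With parameter \<open>e / 2\<close> a bad tuple has weight at least
  \<open>exp (e\<^sup>2 * k / 2)\<close>, whereas one coordinate contributes on average at most
  \<open>exp (e\<^sup>2 / 4)\<close>, its linear term vanishing.\<close>

lemma card_large_deviation:
  fixes z :: "'a \<Rightarrow> real"
  assumes A: "finite A" and z: "\<And>a. a \<in> A \<Longrightarrow> \<bar>z a\<bar> \<le> 1" "(\<Sum>a\<in>A. z a) = 0"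
    and e: "0 < e" "e \<le> 1"
  shows "card {s \<in> {..<k} \<rightarrow>\<^sub>E A. (\<Sum>i<k. z (s i)) > e * k} \<le> exp (- e\<^sup>2 * k / 4) * card A ^ k"
proof -
  let ?S = "{..<k} \<rightarrow>\<^sub>E A" and ?B = "{s \<in> {..<k} \<rightarrow>\<^sub>E A. (\<Sum>i<k. z (s i)) > e * k}"
  have fS: "finite ?S" using A by (intro finite_PiE) auto
  have "exp (e\<^sup>2 * k / 2) * card ?B = (\<Sum>s\<in>?B. exp (e\<^sup>2 * k / 2))" by simp
  also have "\<dots> \<le> (\<Sum>s\<in>?B. exp (\<Sum>i<k. e / 2 * z (s i)))"
  proof (rule sum_mono)
    fix s assume "s \<in> ?B"
    then have "e / 2 * (e * k) \<le> e / 2 * (\<Sum>i<k. z (s i))"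
      using e by (intro mult_left_mono) auto
    then show "exp (e\<^sup>2 * k / 2) \<le> exp (\<Sum>i<k. e / 2 * z (s i))"
      by (simp add: sum_distrib_left power2_eq_square mult_ac)
  qed
  also have "\<dots> \<le> (\<Sum>s\<in>?S. exp (\<Sum>i<k. e / 2 * z (s i)))" using fS by (intro sum_mono2) auto
  also have "\<dots> = (\<Sum>s\<in>?S. \<Prod>i<k. exp (e / 2 * z (s i)))" by (simp add: exp_sum)
  also have "\<dots> = (\<Prod>i<k. \<Sum>a\<in>A. exp (e / 2 * z a))"
    using A by (subst prod_sum_PiE) auto
  also have "\<dots> = (\<Sum>a\<in>A. exp (e / 2 * z a)) ^ k" by simp
  also have "\<dots> \<le> (card A * exp (e\<^sup>2 / 4)) ^ k"
  proof (rule power_mono)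
    have "(\<Sum>a\<in>A. exp (e / 2 * z a)) \<le> (\<Sum>a\<in>A. 1 + e / 2 * z a + e\<^sup>2 / 4)"
    proof (rule sum_mono)
      fix a assume a: "a \<in> A"
      have "\<bar>e / 2 * z a\<bar> \<le> 1 * 1" unfolding abs_mult using e z(1)[OF a] by (intro mult_mono) auto
      moreover have "(z a)\<^sup>2 \<le> 1" using z(1)[OF a] abs_square_le_1 by blast
      then have "(e / 2 * z a)\<^sup>2 \<le> e\<^sup>2 / 4"
        using mult_left_mono[of "(z a)\<^sup>2" 1 "e\<^sup>2 / 4"] by (simp add: power_mult_distrib power_divide)
      ultimately show "exp (e / 2 * z a) \<le> 1 + e / 2 * z a + e\<^sup>2 / 4"
        using exp_le_quadratic[of "e / 2 * z a"] by linarith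
    qed
    also have "\<dots> = card A * (1 + e\<^sup>2 / 4)"
      using z(2) by (simp add: sum.distrib sum_distrib_left[symmetric] sum_divide_distrib[symmetric] algebra_simps)
    also have "\<dots> \<le> card A * exp (e\<^sup>2 / 4)" by (intro mult_left_mono exp_ge_add_one_self) auto
    finally show "(\<Sum>a\<in>A. exp (e / 2 * z a)) \<le> card A * exp (e\<^sup>2 / 4)" .
  qed (simp add: sum_nonneg)
  also have "\<dots> = exp (e\<^sup>2 * k / 2) * (exp (- e\<^sup>2 * k / 4) * card A ^ k)"
    by (simp add: power_mult_distrib exp_of_nat_mult[symmetric] mult_exp_exp[symmetric] mult.assoc[symmetric])
       (simp add: mult_exp_exp algebra_simps)
  finally show ?thesis by simp
qed

lemma card_large_abs_deviation:
  fixes z :: "'a \<Rightarrow> real"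
  assumes A: "finite A" and z: "\<And>a. a \<in> A \<Longrightarrow> \<bar>z a\<bar> \<le> 1" "(\<Sum>a\<in>A. z a) = 0"
    and e: "0 < e" "e \<le> 1"
  shows "card {s \<in> {..<k} \<rightarrow>\<^sub>E A. \<bar>\<Sum>i<k. z (s i)\<bar> > e * k} \<le> 2 * exp (- e\<^sup>2 * k / 4) * card A ^ k"
proof -
  let ?B = "\<lambda>z. {s \<in> {..<k} \<rightarrow>\<^sub>E A. (\<Sum>i<k. z (s i)) > e * k}"
  have "{s \<in> {..<k} \<rightarrow>\<^sub>E A. \<bar>\<Sum>i<k. z (s i)\<bar> > e * k} = ?B z \<union> ?B (\<lambda>a. - z a)"
  proof -
    have "\<bar>r\<bar> > e * k \<longleftrightarrow> r > e * k \<or> - r > e * k" for r :: real by linarith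
    then show ?thesis unfolding sum_negf by blast
  qed
  then have "card {s \<in> {..<k} \<rightarrow>\<^sub>E A. \<bar>\<Sum>i<k. z (s i)\<bar> > e * k} \<le> card (?B z) + card (?B (\<lambda>a. - z a))"
    by (simp add: card_Un_le)
  also have "real \<dots> \<le> 2 * (exp (- e\<^sup>2 * k / 4) * card A ^ k)"
    using card_large_deviation[OF A z e, of k] card_large_deviation[OF A, of "\<lambda>a. - z a" e k] z e
    by (simp add: sum_negf)
  finally show ?thesis by simp
qed

section \<open>Double counting and sets of almost periods\<close>

lemma card_filter_sum: "finite A \<Longrightarrow> card {x \<in> A. P x} = (\<Sum>x\<in>A. of_bool (P x))"
  by (simp add: of_bool_def sum.If_cases Int_def)

lemma card_filter_swap:
  assumes "finite A" "finite B"
  shows "(\<Sum>x\<in>A. card {y \<in> B. R x y}) = (\<Sum>y\<in>B. card {x \<in> A. R x y})"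
  unfolding card_filter_sum[OF assms(1)] card_filter_sum[OF assms(2)] by (rule sum.swap)

lemma markov_half:
  fixes w :: "'a \<Rightarrow> real" and m :: real
  assumes "finite S" "\<And>s. s \<in> S \<Longrightarrow> w s \<ge> 0" "(\<Sum>s\<in>S. w s) \<le> m * card S" "m > 0"
  shows "card S \<le> 2 * card {s \<in> S. w s \<le> 2 * m}"
proof -
  let ?B = "{s \<in> S. \<not> w s \<le> 2 * m}"
  have "2 * m * card ?B = (\<Sum>s\<in>?B. 2 * m)" by simp
  also have "\<dots> \<le> (\<Sum>s\<in>?B. w s)" by (intro sum_mono) auto
  also have "\<dots> \<le> (\<Sum>s\<in>S. w s)" using assms by (intro sum_mono2) auto
  finally have "2 * m * card ?B \<le> m * card S" using assms by linarith
  then have "2 * real (card ?B) \<le> card S" using assms(4) by simp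
  moreover have "card S = card {s \<in> S. w s \<le> 2 * m} + card ?B"
    using assms(1) by (subst card_Un_disjoint[symmetric]) (auto intro: arg_cong[where f = card])
  ultimately show ?thesis by linarith
qed

text \<open>Pigeonhole: the diagonal translates of \<open>L\<close> by all \<open>t \<in> G\<close>
  lie among \<open>card G ^ k\<close> tuples, so some \<open>b\<close> belongs to at least the
  average number of them.\<close>

lemma popular_translate:
  fixes G :: "'g::ab_group_add set"
  assumes G: "finite G" "add_subgroup G" and L: "L \<subseteq> {..<k} \<rightarrow>\<^sub>E G"
  obtains b where "b \<in> {..<k} \<rightarrow>\<^sub>E G"
    "card G * card L \<le> card {t \<in> G. (\<lambda>i\<in>{..<k}. b i - t) \<in> L} * card G ^ k"
proof -
  let ?S = "{..<k} \<rightarrow>\<^sub>E G" and ?n = "\<lambda>b. card {t \<in> G. (\<lambda>i\<in>{..<k}. b i - t) \<in> L}"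
  have fS: "finite ?S" using G by (intro finite_PiE) auto
  have ne: "?S \<noteq> {}" using add_subgroup_zero[OF G(2)] by (auto simp: PiE_eq_empty_iff)
  have "card L \<le> card {b \<in> ?S. (\<lambda>i\<in>{..<k}. b i - t) \<in> L}" if t: "t \<in> G" for t
  proof (rule card_inj_on_le[where f = "\<lambda>s. \<lambda>i\<in>{..<k}. s i + t"])
    have id: "(\<lambda>i\<in>{..<k}. (\<lambda>i\<in>{..<k}. s i + t) i - t) = s" if "s \<in> L" for s
      using that L by (auto simp: fun_eq_iff PiE_def extensional_def)
    show "inj_on (\<lambda>s. \<lambda>i\<in>{..<k}. s i + t) L"
      by (rule inj_on_inverseI[where g = "\<lambda>s. \<lambda>i\<in>{..<k}. s i - t"]) (rule id)
    show "(\<lambda>s. \<lambda>i\<in>{..<k}. s i + t) ` L \<subseteq> {b \<in> ?S. (\<lambda>i\<in>{..<k}. b i - t) \<in> L}"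
    proof (rule image_subsetI)
      fix s assume s: "s \<in> L"
      then have "s \<in> ?S" using L by blast
      then have "(\<lambda>i\<in>{..<k}. s i + t) \<in> ?S" using t G by (auto intro!: add_subgroup_add dest: PiE_mem)
      then show "(\<lambda>i\<in>{..<k}. s i + t) \<in> {b \<in> ?S. (\<lambda>i\<in>{..<k}. b i - t) \<in> L}"
        using s id[OF s] by simp
    qed
    show "finite {b \<in> ?S. (\<lambda>i\<in>{..<k}. b i - t) \<in> L}" using fS by auto
  qed
  then have "card G * card L \<le> (\<Sum>t\<in>G. card {b \<in> ?S. (\<lambda>i\<in>{..<k}. b i - t) \<in> L})"
    using sum_bounded_below[of G "card L"] by simp
  also have "\<dots> = (\<Sum>b\<in>?S. ?n b)" by (rule card_filter_swap[OF G(1) fS])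
  also have "\<dots> \<le> card ?S * Max (?n ` ?S)"
    using sum_bounded_above[of ?S ?n "Max (?n ` ?S)"] fS by simp
  finally have le: "card G * card L \<le> Max (?n ` ?S) * card G ^ k" by (simp add: card_PiE mult.commute)
  have "Max (?n ` ?S) \<in> ?n ` ?S" using fS ne by (intro Max_in) auto
  then obtain b where "b \<in> ?S" "Max (?n ` ?S) = ?n b" by blast
  with le that show ?thesis by simp
qed

text \<open>A sample \<open>s\<close> of \<open>k\<close> points of \<open>A\<close> gives a
  function \<open>E s\<close> that is typically close to \<open>F\<close> at most points; at least
  half of the samples are good in this sense. If \<open>b - t\<close> and \<open>b - t'\<close> are
  both good, the translates of \<open>F\<close> by \<open>t\<close> and by \<open>t'\<close> are
  close to the same function \<open>E b\<close>, hence to each other. A \<open>b\<close> with many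
  such \<open>t\<close> comes from \<open>popular_translate\<close>.\<close>

theorem croot_sisask:
  fixes G A :: "'g::ab_group_add set" and f :: "'g \<Rightarrow> real"
  assumes G: "finite G" "add_subgroup G" and A: "A \<subseteq> G" "A \<noteq> {}"
    and f: "\<And>x. 0 \<le> f x" "\<And>x. f x \<le> 1" and e: "0 < e" "e \<le> 1" and k: "k > 0"
  obtains T where "T \<subseteq> G" "card T \<ge> (card A / card G) ^ k / 2 * card G"
    "\<forall>t\<in>T. \<forall>t'\<in>T.
       card {y \<in> G. \<bar>shift_avg A f (y + t) - shift_avg A f (y + t')\<bar> > 2 * e}
         \<le> 8 * exp (- e\<^sup>2 * k / 4) * card G"
proof -
  have fA: "finite A" using A G finite_subset by blast
  have cA: "card A > 0" using fA A by (simp add: card_gt_0_iff)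
  have cG: "card G > 0" using G add_subgroup_zero by (auto simp: card_gt_0_iff)
  define F where "F = shift_avg A f"
  have F: "0 \<le> F x" "F x \<le> 1" for x
    using f fA by (auto simp: F_def shift_avg_nonneg shift_avg_le_1)
  define E where "E s x = (\<Sum>i<k. f (x + s i)) / k" for s :: "nat \<Rightarrow> 'g" and x
  define S where "S = {..<k} \<rightarrow>\<^sub>E A"
  have fS: "finite S" using fA by (auto simp: S_def intro!: finite_PiE)
  have cS: "card S = card A ^ k" by (simp add: S_def card_PiE)
  \<comment> \<open>The failure rate at one point \<open>x\<close>. The \<open>8\<close> of the
    conclusion is this \<open>2\<close>, doubled by Markov's inequality and again by the union over
    \<open>t\<close> and \<open>t'\<close>.\<close>
  define q where "q = 2 * exp (- e\<^sup>2 * k / 4)"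
  define w where "w s = card {x \<in> G. \<bar>E s x - F x\<bar> > e}" for s
  have dev: "card {s \<in> S. \<bar>E s x - F x\<bar> > e} \<le> q * card S" for x
  proof -
    have "\<bar>f (x + a) - F x\<bar> \<le> 1" for a using f[of "x + a"] F[of x] by linarith
    moreover have "(\<Sum>a\<in>A. f (x + a) - F x) = 0"
      using cA by (simp add: sum_subtractf F_def shift_avg_def)
    ultimately have "card {s \<in> S. \<bar>\<Sum>i<k. f (x + s i) - F x\<bar> > e * k} \<le> q * card S"
      using card_large_abs_deviation[OF fA, of "\<lambda>a. f (x + a) - F x" e k] e
      by (simp add: S_def[symmetric] q_def cS)
    moreover have "(\<bar>\<Sum>i<k. f (x + s i) - F x\<bar> > e * k) = (\<bar>E s x - F x\<bar> > e)" for s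
    proof -
      have "(\<Sum>i<k. f (x + s i) - F x) = k * (E s x - F x)"
        using k by (simp add: E_def sum_subtractf field_simps)
      then show ?thesis using k by (simp add: abs_mult mult.commute)
    qed
    ultimately show ?thesis by simp
  qed
  have "(\<Sum>s\<in>S. real (w s)) = real (\<Sum>x\<in>G. card {s \<in> S. \<bar>E s x - F x\<bar> > e})"
    unfolding w_def of_nat_sum[symmetric] by (subst card_filter_swap[OF fS G(1)]) simp
  also have "\<dots> \<le> card G * (q * card S)"
    using sum_bounded_above[of G "\<lambda>x. real (card {s \<in> S. \<bar>E s x - F x\<bar> > e})" "q * card S"] dev by simp
  finally have "(\<Sum>s\<in>S. real (w s)) \<le> (q * card G) * card S" by (simp add: mult_ac)
  then have half: "card S \<le> 2 * card {s \<in> S. real (w s) \<le> 2 * (q * card G)}"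
    using fS cG by (intro markov_half) (auto simp: q_def)
  define L where "L = {s \<in> S. real (w s) \<le> 2 * (q * card G)}"
  have "L \<subseteq> {..<k} \<rightarrow>\<^sub>E G" using PiE_mono[of "{..<k}" "\<lambda>_. A" "\<lambda>_. G"] A unfolding L_def S_def by blast
  then obtain b where b: "b \<in> {..<k} \<rightarrow>\<^sub>E G"
    "card G * card L \<le> card {t \<in> G. (\<lambda>i\<in>{..<k}. b i - t) \<in> L} * card G ^ k"
    by (rule popular_translate[OF G])
  define T where "T = {t \<in> G. (\<lambda>i\<in>{..<k}. b i - t) \<in> L}"
  have TG: "T \<subseteq> G" by (auto simp: T_def)
  have near: "card {y \<in> G. \<bar>E b y - F (y + t)\<bar> > e} \<le> 2 * (q * card G)" if t: "t \<in> T" for t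
  proof -
    let ?s = "\<lambda>i\<in>{..<k}. b i - t"
    have tG: "t \<in> G" using t TG by auto
    have "E ?s (y + t) = E b y" for y
      unfolding E_def by (intro arg_cong2[where f = "(/)"] sum.cong refl) (simp add: algebra_simps)
    then have "card {y \<in> G. \<bar>E b y - F (y + t)\<bar> > e} \<le> w ?s"
      unfolding w_def using G tG
      by (intro card_inj_on_le[where f = "\<lambda>y. y + t"]) (auto intro: add_subgroup_add)
    moreover have "real (w ?s) \<le> 2 * (q * card G)" using t by (simp add: T_def L_def)
    ultimately show ?thesis by linarith
  qed
  show ?thesis
  proof (rule that[OF TG _ ballI[OF ballI]])
    have "real (card G) * card L \<le> real (card T) * real (card G) ^ k"
      using b(2) unfolding T_def[symmetric] by (simp flip: of_nat_mult of_nat_power)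
    moreover have "real (card G) * real (card A) ^ k \<le> real (card G) * (2 * real (card L))"
    proof (rule mult_left_mono)
      have "real (card S) = real (card A) ^ k" by (simp add: cS)
      moreover have "real (card S) \<le> 2 * real (card L)" using half unfolding L_def by linarith
      ultimately show "real (card A) ^ k \<le> 2 * real (card L)" by simp
    qed simp
    ultimately have "real (card G) * real (card A) ^ k \<le> 2 * (real (card T) * real (card G) ^ k)" by linarith
    then show "card T \<ge> (card A / card G) ^ k / 2 * card G"
      using cG by (simp add: field_simps)
    fix t t' assume t: "t \<in> T" "t' \<in> T"
    let ?N = "\<lambda>t. {y \<in> G. \<bar>E b y - F (y + t)\<bar> > e}"
    have "{y \<in> G. \<bar>F (y + t) - F (y + t')\<bar> > 2 * e} \<subseteq> ?N t \<union> ?N t'" by auto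
    then have "card {y \<in> G. \<bar>F (y + t) - F (y + t')\<bar> > 2 * e} \<le> card (?N t) + card (?N t')"
      using G by (intro order_trans[OF card_mono card_Un_le]) auto
    also have "real \<dots> \<le> 4 * (q * card G)" using near[OF t(1)] near[OF t(2)] by simp
    finally show "card {y \<in> G. \<bar>shift_avg A f (y + t) - shift_avg A f (y + t')\<bar> > 2 * e}
         \<le> 8 * exp (- e\<^sup>2 * k / 4) * card G" by (simp add: F_def q_def)
  qed
qed

section \<open>Dense sets\<close>

text \<open>Axiomatises a set \<open>X\<close> that acts as the dual group of \<open>G\<close>; the
  last clause is the orthogonality relation behind Parseval's identity and Fourier
  inversion.\<close>

definition dual_system :: "nat \<Rightarrow> 'g::ab_group_add set \<Rightarrow> ('g \<Rightarrow> complex) set \<Rightarrow> bool" where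
  "dual_system p G X \<longleftrightarrow> finite X \<and> (\<forall>\<chi>\<in>X. character G \<chi> \<and> (\<forall>x\<in>G. \<chi> x ^ p = 1)) \<and>
     (\<forall>x\<in>G. (\<Sum>\<chi>\<in>X. \<chi> x) = (if x = 0 then of_nat (card G) else 0))"

definition char_avg :: "'g set \<Rightarrow> ('g \<Rightarrow> complex) \<Rightarrow> complex" where
  "char_avg A \<chi> = (\<Sum>a\<in>A. \<chi> a) / card A"

text \<open>Expanding the squared modulus, orthogonality leaves only the diagonal terms
  \<open>a = b\<close>.\<close>

lemma parseval:
  assumes X: "dual_system p G X" and G: "finite G" "add_subgroup G" and A: "A \<subseteq> G" "A \<noteq> {}"
  shows "(\<Sum>\<chi>\<in>X. (norm (char_avg A \<chi>))\<^sup>2) = card G / card A"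
proof -
  have fA: "finite A" using A G finite_subset by blast
  then have cA: "card A > 0" using A by (simp add: card_gt_0_iff)
  have char: "character G \<chi>" if "\<chi> \<in> X" for \<chi> using X that by (simp add: dual_system_def)
  have "complex_of_real (\<Sum>\<chi>\<in>X. (norm (\<Sum>a\<in>A. \<chi> a))\<^sup>2) = (\<Sum>\<chi>\<in>X. \<Sum>a\<in>A. \<Sum>b\<in>A. \<chi> (a - b))"
    unfolding of_real_sum
  proof (rule sum.cong[OF refl])
    fix \<chi> assume \<chi>: "\<chi> \<in> X"
    have "complex_of_real ((norm (\<Sum>a\<in>A. \<chi> a))\<^sup>2) = (\<Sum>a\<in>A. \<chi> a) * cnj (\<Sum>a\<in>A. \<chi> a)"
      by (rule complex_norm_square)
    also have "\<dots> = (\<Sum>a\<in>A. \<Sum>b\<in>A. \<chi> a * cnj (\<chi> b))" by (simp add: sum_product)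
    also have "\<dots> = (\<Sum>a\<in>A. \<Sum>b\<in>A. \<chi> (a - b))"
      by (intro sum.cong refl) (simp add: character_diff[OF char[OF \<chi>] G(2)] subsetD[OF A(1)])
    finally show "complex_of_real ((norm (\<Sum>a\<in>A. \<chi> a))\<^sup>2) = (\<Sum>a\<in>A. \<Sum>b\<in>A. \<chi> (a - b))" .
  qed
  also have "\<dots> = (\<Sum>a\<in>A. \<Sum>b\<in>A. \<Sum>\<chi>\<in>X. \<chi> (a - b))"
    by (subst sum.swap) (intro sum.cong refl sum.swap)
  also have "\<dots> = (\<Sum>a\<in>A. \<Sum>b\<in>A. if b = a then of_nat (card G) else 0)"
  proof (intro sum.cong refl)
    fix a b assume "a \<in> A" "b \<in> A"
    then have "a - b \<in> G" using A G by (intro add_subgroup_diff) auto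
    then show "(\<Sum>\<chi>\<in>X. \<chi> (a - b)) = (if b = a then of_nat (card G) else 0)"
      using X by (auto simp: dual_system_def)
  qed
  also have "\<dots> = complex_of_real (real (card A) * card G)" using fA by (simp add: sum.delta')
  finally have "(\<Sum>\<chi>\<in>X. (norm (\<Sum>a\<in>A. \<chi> a))\<^sup>2) = real (card A) * card G"
    unfolding of_real_eq_iff .
  then show ?thesis
    using cA by (simp add: char_avg_def norm_divide power_divide sum_divide_distrib[symmetric] power2_eq_square)
qed

text \<open>Fourier coefficients are carried along as a relation, so that an averaging operator
  simply multiplies them by \<open>char_avg\<close>.\<close>

definition expands :: "'g set \<Rightarrow> ('g \<Rightarrow> complex) set \<Rightarrow> (('g \<Rightarrow> complex) \<Rightarrow> complex) \<Rightarrow> ('g \<Rightarrow> real) \<Rightarrow> bool"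
  where "expands G X c f \<longleftrightarrow> (\<forall>x\<in>G. of_real (f x) = (\<Sum>\<chi>\<in>X. c \<chi> * \<chi> x))"

lemma fourier_inversion:
  assumes X: "dual_system p G X" and G: "finite G" "add_subgroup G"
    and f: "\<And>x. 0 \<le> f x" "\<And>x. f x \<le> 1"
  obtains c where "expands G X c f" "\<forall>\<chi>\<in>X. norm (c \<chi>) \<le> 1"
proof -
  have cG: "card G > 0" using G add_subgroup_zero by (auto simp: card_gt_0_iff)
  have char: "character G \<chi>" if "\<chi> \<in> X" for \<chi> using X that by (simp add: dual_system_def)
  define c where "c \<chi> = (\<Sum>y\<in>G. of_real (f y) * cnj (\<chi> y)) / card G" for \<chi>
  have "expands G X c f" unfolding expands_def
  proof
    fix x assume x: "x \<in> G"
    have "(\<Sum>\<chi>\<in>X. c \<chi> * \<chi> x) = (\<Sum>\<chi>\<in>X. \<Sum>y\<in>G. of_real (f y) * \<chi> (x - y) / card G)"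
    proof (rule sum.cong[OF refl])
      fix \<chi> assume \<chi>: "\<chi> \<in> X"
      show "c \<chi> * \<chi> x = (\<Sum>y\<in>G. of_real (f y) * \<chi> (x - y) / card G)"
        unfolding c_def sum_divide_distrib sum_distrib_right
        by (intro sum.cong refl) (simp add: character_diff[OF char[OF \<chi>] G(2) x])
    qed
    also have "\<dots> = (\<Sum>y\<in>G. of_real (f y) * (\<Sum>\<chi>\<in>X. \<chi> (x - y)) / card G)"
      unfolding sum_distrib_left sum_divide_distrib by (rule sum.swap)
    also have "\<dots> = (\<Sum>y\<in>G. if y = x then of_real (f y) else 0)"
    proof (intro sum.cong refl)
      fix y assume "y \<in> G"
      then have "x - y \<in> G" using x G by (intro add_subgroup_diff) auto
      then show "of_real (f y) * (\<Sum>\<chi>\<in>X. \<chi> (x - y)) / card G = (if y = x then of_real (f y) else 0)"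
        using X cG by (auto simp: dual_system_def)
    qed
    also have "\<dots> = of_real (f x)" using x G by simp
    finally show "of_real (f x) = (\<Sum>\<chi>\<in>X. c \<chi> * \<chi> x)" by simp
  qed
  moreover have "norm (c \<chi>) \<le> 1" if \<chi>: "\<chi> \<in> X" for \<chi>
  proof -
    have "norm (\<Sum>y\<in>G. of_real (f y) * cnj (\<chi> y)) \<le> (\<Sum>y\<in>G. norm (of_real (f y) * cnj (\<chi> y)))"
      by (rule norm_sum)
    also have "\<dots> \<le> (\<Sum>y\<in>G. 1)"
      using f character_norm[OF char[OF \<chi>]] by (intro sum_mono) (simp add: norm_mult)
    finally show ?thesis using cG by (simp add: c_def norm_divide)
  qed
  ultimately show ?thesis using that by blast
qed

lemma expands_shift_avg:
  assumes f: "expands G X c f" and X: "dual_system p G X" and G: "add_subgroup G" and A: "A \<subseteq> G"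
  shows "expands G X (\<lambda>\<chi>. c \<chi> * char_avg A \<chi>) (shift_avg A f)"
  unfolding expands_def
proof
  fix x assume x: "x \<in> G"
  have "complex_of_real (shift_avg A f x) = (\<Sum>a\<in>A. complex_of_real (f (x + a))) / card A"
    by (simp add: shift_avg_def)
  also have "\<dots> = (\<Sum>a\<in>A. \<Sum>\<chi>\<in>X. c \<chi> * \<chi> (x + a)) / card A"
  proof (intro arg_cong2[where f = "(/)"] sum.cong refl)
    fix a assume "a \<in> A"
    then have "x + a \<in> G" using x A G by (intro add_subgroup_add) auto
    then show "complex_of_real (f (x + a)) = (\<Sum>\<chi>\<in>X. c \<chi> * \<chi> (x + a))"
      using f by (auto simp: expands_def)
  qed
  also have "\<dots> = (\<Sum>\<chi>\<in>X. \<Sum>a\<in>A. c \<chi> * \<chi> (x + a)) / card A" by (subst sum.swap) simp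
  also have "\<dots> = (\<Sum>\<chi>\<in>X. c \<chi> * char_avg A \<chi> * \<chi> x)"
    unfolding sum_divide_distrib[of _ X]
  proof (intro sum.cong refl)
    fix \<chi> assume "\<chi> \<in> X"
    then have "character G \<chi>" using X by (simp add: dual_system_def)
    then have "(\<Sum>a\<in>A. c \<chi> * \<chi> (x + a)) = (\<Sum>a\<in>A. c \<chi> * \<chi> x * \<chi> a)"
      using x A by (intro sum.cong refl) (auto simp: character_add)
    then show "(\<Sum>a\<in>A. c \<chi> * \<chi> (x + a)) / card A = c \<chi> * char_avg A \<chi> * \<chi> x"
      by (simp add: char_avg_def sum_distrib_left mult_ac)
  qed
  finally show "complex_of_real (shift_avg A f x) = (\<Sum>\<chi>\<in>X. c \<chi> * char_avg A \<chi> * \<chi> x)" .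
qed

section \<open>Iterated averaging over differences\<close>

lemma norm_char_avg_uminus:
  assumes "character G \<chi>" "add_subgroup G" "A \<subseteq> G"
  shows "norm (char_avg (uminus ` A) \<chi>) = norm (char_avg A \<chi>)"
proof -
  have "\<chi> (- a) = cnj (\<chi> a)" if "a \<in> A" for a
    using character_diff[OF assms(1,2) add_subgroup_zero[OF assms(2)], of a] that assms
    by (auto simp: character_zero)
  then have "(\<Sum>a\<in>uminus ` A. \<chi> a) = cnj (\<Sum>a\<in>A. \<chi> a)"
    by (simp add: sum.reindex)
  then have "norm (\<Sum>a\<in>uminus ` A. \<chi> a) = norm (\<Sum>a\<in>A. \<chi> a)"
    by (simp only: complex_mod_cnj)
  moreover have "card (uminus ` A) = card A" by (intro card_image) auto
  ultimately show ?thesis by (simp add: char_avg_def norm_divide)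
qed

text \<open>The average over all shifts \<open>t - t'\<close> with \<open>t\<close> and
  \<open>t'\<close> in \<open>T\<close>; for characters, the multiplier is the squared modulus of
  the mean of \<open>\<chi>\<close> on \<open>T\<close>.\<close>

definition sym_avg :: "'g::ab_group_add set \<Rightarrow> ('g \<Rightarrow> real) \<Rightarrow> 'g \<Rightarrow> real" where
  "sym_avg T f = shift_avg (uminus ` T) (shift_avg T f)"

lemma uminus_image_subgroup: "add_subgroup G \<Longrightarrow> A \<subseteq> G \<Longrightarrow> uminus ` A \<subseteq> G"
  by (auto intro: add_subgroup_uminus)

lemma expands_sym_avg_iter:
  assumes f: "expands G X c f" and X: "dual_system p G X" and G: "add_subgroup G" and T: "T \<subseteq> G"
  shows "expands G X (\<lambda>\<chi>. c \<chi> * (char_avg T \<chi> * char_avg (uminus ` T) \<chi>) ^ l) ((sym_avg T ^^ l) f)"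
proof (induction l)
  case (Suc l)
  show ?case
    using expands_shift_avg[OF expands_shift_avg[OF Suc X G T] X G uminus_image_subgroup[OF G T]]
    by (simp add: sym_avg_def mult_ac)
qed (use f in simp)

lemma sum_abs_shift_avg_le:
  assumes "finite S" "S \<noteq> {}" and le: "\<And>t. t \<in> S \<Longrightarrow> (\<Sum>x\<in>B. \<bar>g (u x + t) - F x\<bar>) \<le> \<delta>"
  shows "(\<Sum>x\<in>B. \<bar>shift_avg S g (u x) - F x\<bar>) \<le> \<delta>"
proof -
  have cS: "card S > 0" using assms by (simp add: card_gt_0_iff)
  have "(\<Sum>x\<in>B. \<bar>shift_avg S g (u x) - F x\<bar>) \<le> (\<Sum>x\<in>B. (\<Sum>t\<in>S. \<bar>g (u x + t) - F x\<bar>) / card S)"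
  proof (rule sum_mono)
    fix x
    have "shift_avg S g (u x) - F x = (\<Sum>t\<in>S. g (u x + t) - F x) / card S"
      using cS by (simp add: shift_avg_def sum_subtractf field_simps)
    then show "\<bar>shift_avg S g (u x) - F x\<bar> \<le> (\<Sum>t\<in>S. \<bar>g (u x + t) - F x\<bar>) / card S"
      by (simp add: divide_right_mono)
  qed
  also have "\<dots> = (\<Sum>t\<in>S. \<Sum>x\<in>B. \<bar>g (u x + t) - F x\<bar>) / card S"
    unfolding sum_divide_distrib[symmetric] by (subst sum.swap) simp
  also have "\<dots> \<le> (card S * \<delta>) / card S"
    using sum_bounded_above[of S _ \<delta>] le by (intro divide_right_mono) auto
  finally show ?thesis using cS by simp
qed

text \<open>Each averaging costs \<open>\<delta>\<close> by the triangle inequality.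
  \<open>B\<close> is not invariant under shifts, so the induction needs all base points
  \<open>s\<close>: a shift by \<open>t - r\<close> moves \<open>s\<close> to
  \<open>s - r + t\<close>.\<close>

lemma sum_abs_sym_avg_iter_le:
  fixes G :: "'g::ab_group_add set"
  assumes G: "add_subgroup G" and T: "finite T" "T \<noteq> {}" "T \<subseteq> G"
    and step: "\<And>s t t'. s \<in> G \<Longrightarrow> t \<in> T \<Longrightarrow> t' \<in> T \<Longrightarrow>
      (\<Sum>x\<in>B. \<bar>F (s + x - t' + t) - F (s + x)\<bar>) \<le> \<delta>"
    and s: "s \<in> G"
  shows "(\<Sum>x\<in>B. \<bar>(sym_avg T ^^ l) F (s + x) - F (s + x)\<bar>) \<le> l * \<delta>"
  using s
proof (induction l arbitrary: s)
  case (Suc l)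
  let ?g = "(sym_avg T ^^ l) F"
  have "(\<Sum>x\<in>B. \<bar>?g (s + x + t' + t) - F (s + x)\<bar>) \<le> Suc l * \<delta>"
    if t: "t \<in> T" "t' \<in> uminus ` T" for t t'
  proof -
    obtain r where r: "r \<in> T" "t' = - r" using t(2) by auto
    have s': "s - r + t \<in> G" using Suc.prems r t T G
      by (intro add_subgroup_add add_subgroup_diff) auto
    have "(\<Sum>x\<in>B. \<bar>?g (s + x + t' + t) - F (s + x)\<bar>)
        \<le> (\<Sum>x\<in>B. \<bar>?g (s - r + t + x) - F (s - r + t + x)\<bar> + \<bar>F (s + x - r + t) - F (s + x)\<bar>)"
    proof (rule sum_mono)
      fix x
      have eq: "s + x + t' + t = s - r + t + x" "s + x - r + t = s - r + t + x"
        using r by (simp_all add: algebra_simps)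
      show "\<bar>?g (s + x + t' + t) - F (s + x)\<bar>
        \<le> \<bar>?g (s - r + t + x) - F (s - r + t + x)\<bar> + \<bar>F (s + x - r + t) - F (s + x)\<bar>"
        unfolding eq by linarith
    qed
    also have "\<dots> \<le> l * \<delta> + \<delta>"
      unfolding sum.distrib by (intro add_mono Suc.IH s' step Suc.prems r t)
    finally show ?thesis by (simp add: algebra_simps)
  qed
  then show ?case
    unfolding funpow.simps comp_def sym_avg_def[of T ?g]
    using T by (intro sum_abs_shift_avg_le) auto
qed simp

text \<open>The sum of an average over a translate of \<open>V\<close> is an average of such sums of
  \<open>g\<close>, so a bound uniform in the translate is inherited.\<close>

lemma coset_sum_shift_avg_le:
  assumes G: "add_subgroup G" and S: "finite S" "S \<noteq> {}" "S \<subseteq> G"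
    and le: "\<And>y. y \<in> G \<Longrightarrow> (\<Sum>v\<in>V. g (v + y)) \<le> \<delta>" and y: "y \<in> G"
  shows "(\<Sum>v\<in>V. shift_avg S g (v + y)) \<le> \<delta>"
proof -
  have cS: "card S > 0" using S by (simp add: card_gt_0_iff)
  have "(\<Sum>v\<in>V. shift_avg S g (v + y)) = (\<Sum>t\<in>S. \<Sum>v\<in>V. g (v + (y + t))) / card S"
    unfolding shift_avg_def sum_divide_distrib[symmetric] by (subst sum.swap) (simp add: add.assoc)
  also have "\<dots> \<le> (card S * \<delta>) / card S"
    using sum_bounded_above[of S "\<lambda>t. \<Sum>v\<in>V. g (v + (y + t))" \<delta>] le add_subgroup_add[OF G y] S
    by (intro divide_right_mono) auto
  finally show ?thesis using cS by simp
qed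

lemma coset_sum_sym_avg_iter_le:
  assumes G: "add_subgroup G" and S: "finite S" "S \<noteq> {}" "S \<subseteq> G"
    and le: "\<And>y. y \<in> G \<Longrightarrow> (\<Sum>v\<in>V. g (v + y)) \<le> \<delta>" and y: "y \<in> G"
  shows "(\<Sum>v\<in>V. (sym_avg S ^^ l) g (v + y)) \<le> \<delta>"
  using y
proof (induction l arbitrary: y)
  case (Suc l)
  show ?case
    unfolding funpow.simps comp_def sym_avg_def[of S "(sym_avg S ^^ l) g"]
    using Suc G S uminus_image_subgroup[OF G S(3)]
    by (intro coset_sum_shift_avg_le[OF G]) auto
qed (use le in simp)

text \<open>\<open>P\<close> and \<open>w + P\<close> both lie in \<open>V\<close> and each fills
  more than half of it, so they meet; a common point writes \<open>w\<close> as a difference of two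
  elements of \<open>D\<close>.\<close>

lemma subgroup_subset_difference:
  fixes V :: "'g::ab_group_add set"
  assumes V: "add_subgroup V" "finite V" and half: "2 * card {v \<in> V. v + y \<in> D} > card V"
  shows "V \<subseteq> D + uminus ` D"
proof
  fix w assume w: "w \<in> V"
  define P where "P = {v \<in> V. v + y \<in> D}"
  have fP: "finite P" using V by (simp add: P_def)
  have "P \<inter> (+) w ` P \<noteq> {}"
  proof
    assume "P \<inter> (+) w ` P = {}"
    then have "card (P \<union> (+) w ` P) = card P + card ((+) w ` P)" using fP by (intro card_Un_disjoint) auto
    also have "card ((+) w ` P) = card P" by (intro card_image) (auto simp: inj_on_def)
    finally have "card (P \<union> (+) w ` P) = 2 * card P" by simp
    moreover have "card (P \<union> (+) w ` P) \<le> card V"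
      using V w by (intro card_mono) (auto simp: P_def intro: add_subgroup_add)
    ultimately show False using half by (simp add: P_def)
  qed
  then obtain v where v: "v + y \<in> D" "w + v + y \<in> D" by (auto simp: P_def)
  have "w = (w + v + y) + - (v + y)" by (simp add: algebra_simps)
  then show "w \<in> D + uminus ` D" using v by (metis imageI set_plus_intro)
qed

text \<open>The numerical hypotheses share out the error: \<open>ek\<close> makes the exceptional
  points of almost periodicity few relative to \<open>A\<close>, \<open>el\<close> limits the loss
  of \<open>l\<close> averagings to \<open>1 / 8\<close>, and \<open>l\<close> limits the Fourier
  tail to \<open>1 / 8\<close>. This leaves \<open>3 / 4\<close>, more than the \<open>1 / 2\<close>
  needed on a coset of \<open>V\<close>.\<close>

theorem bogolyubov_dense:
  fixes G A :: "'g::ab_group_add set" and e :: real and p k l :: nat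
  assumes G: "finite G" "add_subgroup G" and A: "A \<subseteq> G" "A \<noteq> {}"
    and X: "dual_system p G X" and p: "p > 0"
    and e: "0 < e" "e \<le> 1" and k: "k > 0"
    and ek: "8 * exp (- e\<^sup>2 * k / 4) * card G \<le> 2 * e * card A"
    and el: "4 * e * l \<le> 1 / 8" and l: "2 * (1 / 4) ^ l * (card G / card A) \<le> 1 / 8"
  obtains V d where "add_subgroup V" "V \<subseteq> G"
    "V \<subseteq> (A + uminus ` A) + (A + uminus ` A)" "card G \<le> p ^ d * card V"
    "d \<le> 16 * (k * ln (card G / card A) + ln 2)"
proof -
  have fA: "finite A" using A G finite_subset by blast
  have cA: "card A > 0" using fA A by (simp add: card_gt_0_iff)
  have cG: "card G > 0" using G add_subgroup_zero by (auto simp: card_gt_0_iff)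
  define B where "B = uminus ` A"
  have B: "B \<subseteq> G" "B \<noteq> {}" "finite B" "card B = card A"
    using A fA uminus_image_subgroup[OF G(2) A(1)] by (auto simp: B_def card_image)
  define D where "D = A + B"
  define f where "f x = (of_bool (x \<in> D) :: real)" for x
  have f: "0 \<le> f x" "f x \<le> 1" for x by (auto simp: f_def)
  define F where "F = shift_avg A f"
  have F01: "0 \<le> F x" "F x \<le> 1" for x
    using f fA by (auto simp: F_def shift_avg_nonneg shift_avg_le_1)
  have F1: "F x = 1" if "x \<in> B" for x
  proof -
    have "x + a \<in> D" if "a \<in> A" for a
      using set_plus_intro[OF that \<open>x \<in> B\<close>] by (simp add: D_def add.commute)
    then show ?thesis using cA by (simp add: F_def shift_avg_def f_def)
  qed
  obtain T where T: "T \<subseteq> G" "card T \<ge> (card A / card G) ^ k / 2 * card G"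
    and per: "\<forall>t\<in>T. \<forall>t'\<in>T.
       card {y \<in> G. \<bar>F (y + t) - F (y + t')\<bar> > 2 * e} \<le> 8 * exp (- e\<^sup>2 * k / 4) * card G"
    by (rule croot_sisask[where f = f, OF G A f e k, folded F_def])
  have Tpos: "(card A / card G) ^ k / 2 * card G > 0" using cA cG by simp
  then have cT: "card T > 0" using T(2) by (metis less_le_trans of_nat_0_less_iff)
  then have T': "T \<noteq> {}" "finite T" by (auto simp: card_gt_0_iff)
  have per1: "(\<Sum>x\<in>B. \<bar>F (s + x - t' + t) - F (s + x)\<bar>) \<le> 4 * e * card A"
    if "s \<in> G" "t \<in> T" "t' \<in> T" for s t t'
  proof -
    \<comment> \<open>Off the bad points the change is at most \<open>2 * e\<close>, on them at most
      \<open>1\<close> since \<open>F\<close> has values between \<open>0\<close> and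
      \<open>1\<close>. The injection \<open>x \<mapsto> s + x - t'\<close> carries the bad points
      into the exceptional set of \<open>per\<close>.\<close>
    let ?bad = "\<lambda>x. \<bar>F (s + x - t' + t) - F (s + x)\<bar> > 2 * e"
    have "(\<Sum>x\<in>B. \<bar>F (s + x - t' + t) - F (s + x)\<bar>) \<le> (\<Sum>x\<in>B. 2 * e + of_bool (?bad x))"
    proof (rule sum_mono)
      fix x show "\<bar>F (s + x - t' + t) - F (s + x)\<bar> \<le> 2 * e + of_bool (?bad x)"
        using F01[of "s + x - t' + t"] F01[of "s + x"] e by (auto simp: of_bool_def)
    qed
    also have "\<dots> = 2 * e * card A + card {x \<in> B. ?bad x}"
      using B by (simp add: sum.distrib card_filter_sum[OF B(3)] del: sum_of_bool_eq)
    also have "card {x \<in> B. ?bad x} \<le> card {y \<in> G. \<bar>F (y + t) - F (y + t')\<bar> > 2 * e}"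
    proof (rule card_inj_on_le[where f = "\<lambda>x. s + x - t'"])
      show "(\<lambda>x. s + x - t') ` {x \<in> B. ?bad x} \<subseteq> {y \<in> G. \<bar>F (y + t) - F (y + t')\<bar> > 2 * e}"
        using that B T G by (auto intro!: add_subgroup_diff add_subgroup_add)
    qed (use G in \<open>auto simp: inj_on_def\<close>)
    also have "real \<dots> \<le> 2 * e * card A" by (rule order_trans[OF per[rule_format, OF that(2,3)] ek])
    finally show ?thesis by simp
  qed
  have Xc: "\<And>\<chi>. \<chi> \<in> X \<Longrightarrow> character G \<chi>" using X by (simp add: dual_system_def)
  obtain V d where V: "add_subgroup V" "V \<subseteq> G" "card G \<le> p ^ d * card V"
    and d: "d \<le> 16 * ln (card G / card T)"
    and triv: "\<forall>\<chi>\<in>X. norm (\<Sum>x\<in>T. \<chi> x) \<ge> card T / 2 \<longrightarrow> (\<forall>v\<in>V. \<chi> v = 1)"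
    by (rule chang[OF G T(1) T'(1) p, of X]) (use X in \<open>simp add: dual_system_def\<close>)
  have fV: "finite V" using V G finite_subset by blast
  have cV: "card V > 0" using add_subgroup_zero[OF V(1)] fV by (auto simp: card_gt_0_iff)
  define g where "g = (sym_avg T ^^ l) F"
  \<comment> \<open>\<open>h 0\<close> is the mean of \<open>g\<close> over \<open>B\<close>, where
    \<open>F\<close> equals \<open>1\<close>. This last average also supplies a second factor of
    modulus \<open>norm (char_avg A \<chi>)\<close> in the coefficients, so that Parseval's identity
    can sum them.\<close>
  define h where "h = shift_avg B g"
  have "\<bar>(\<Sum>x\<in>B. g x) - card A\<bar> = \<bar>\<Sum>x\<in>B. g (0 + x) - F (0 + x)\<bar>"
    using F1 B by (simp add: sum_subtractf)
  also have "\<dots> \<le> (\<Sum>x\<in>B. \<bar>g (0 + x) - F (0 + x)\<bar>)" by (rule sum_abs)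
  also have "\<dots> \<le> l * (4 * e * card A)"
    unfolding g_def using G T T' per1 add_subgroup_zero[OF G(2)]
    by (intro sum_abs_sym_avg_iter_le[OF G(2)]) auto
  also have "\<dots> = (4 * e * l) * card A" by simp
  also have "\<dots> \<le> 1 / 8 * card A" by (intro mult_right_mono el) auto
  finally have "(\<Sum>x\<in>B. g x) \<ge> 7 / 8 * card A" by linarith
  then have h0: "h 0 \<ge> 7 / 8" using cA B by (simp add: h_def shift_avg_def field_simps)
  obtain c where c: "expands G X c f" "\<forall>\<chi>\<in>X. norm (c \<chi>) \<le> 1"
    by (rule fourier_inversion[where f = f, OF X G f])
  define \<tau> where "\<tau> \<chi> = char_avg T \<chi> * char_avg (uminus ` T) \<chi>" for \<chi>
  define q where "q \<chi> = c \<chi> * char_avg A \<chi> * \<tau> \<chi> ^ l * char_avg B \<chi>" for \<chi>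
  have hq: "expands G X q h"
    unfolding h_def g_def F_def q_def \<tau>_def
    by (intro expands_shift_avg[OF _ X G(2)] expands_sym_avg_iter[OF _ X G(2)] c T A B)
  have close: "h v \<ge> 3 / 4" if v: "v \<in> V" for v
  proof -
    have vG: "v \<in> G" using v V by auto
    \<comment> \<open>Characters trivial at \<open>v\<close> drop out. By \<open>triv\<close> every
      other one has mean below \<open>1 / 2\<close> on \<open>T\<close>, so its multiplier is at
      most \<open>1 / 4\<close> per averaging.\<close>
    have "complex_of_real (h v - h 0) = (\<Sum>\<chi>\<in>X. q \<chi> * \<chi> v) - (\<Sum>\<chi>\<in>X. q \<chi> * \<chi> 0)"
      using hq vG add_subgroup_zero[OF G(2)] by (simp add: expands_def)
    also have "\<dots> = (\<Sum>\<chi>\<in>X. q \<chi> * (\<chi> v - 1))"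
      unfolding sum_subtractf[symmetric]
      by (intro sum.cong refl) (simp add: character_zero[OF Xc G(2)] algebra_simps)
    finally have "\<bar>h v - h 0\<bar> = norm (\<Sum>\<chi>\<in>X. q \<chi> * (\<chi> v - 1))"
      by (metis norm_of_real real_norm_def)
    also have "\<dots> \<le> (\<Sum>\<chi>\<in>X. norm (q \<chi> * (\<chi> v - 1)))" by (rule norm_sum)
    also have "\<dots> \<le> (\<Sum>\<chi>\<in>X. 2 * (1 / 4) ^ l * (norm (char_avg A \<chi>))\<^sup>2)"
    proof (rule sum_mono)
      fix \<chi> assume \<chi>: "\<chi> \<in> X"
      show "norm (q \<chi> * (\<chi> v - 1)) \<le> 2 * (1 / 4) ^ l * (norm (char_avg A \<chi>))\<^sup>2"
      proof (cases "\<chi> v = 1")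
        case False
        then have "norm (\<Sum>x\<in>T. \<chi> x) < card T / 2" using triv \<chi> v by force
        then have half: "norm (char_avg T \<chi>) \<le> 1 / 2"
          using cT by (simp add: char_avg_def norm_divide field_simps)
        have "norm (\<tau> \<chi>) = norm (char_avg T \<chi>) * norm (char_avg T \<chi>)"
          using norm_char_avg_uminus[OF Xc[OF \<chi>] G(2) T(1)] by (simp add: \<tau>_def norm_mult)
        also have "\<dots> \<le> 1 / 2 * (1 / 2)" using half by (intro mult_mono) auto
        finally have m1: "norm (\<tau> \<chi>) ^ l \<le> (1 / 4) ^ l" by (intro power_mono) auto
        have m2: "norm (\<chi> v - 1) \<le> 2"
          using norm_triangle_ineq4[of "\<chi> v" 1] character_norm[OF Xc[OF \<chi>] vG] by simp
        have m3: "norm (q \<chi> * (\<chi> v - 1)) =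
            norm (c \<chi>) * (norm (\<chi> v - 1) * (norm (\<tau> \<chi>) ^ l * (norm (char_avg A \<chi>))\<^sup>2))"
          using norm_char_avg_uminus[OF Xc[OF \<chi>] G(2) A(1)]
          by (simp add: q_def B_def norm_mult norm_power power2_eq_square mult_ac)
        have "norm (q \<chi> * (\<chi> v - 1)) \<le> 1 * (2 * ((1 / 4) ^ l * (norm (char_avg A \<chi>))\<^sup>2))"
          unfolding m3 using m1 m2 c(2) \<chi> by (intro mult_mono) auto
        then show ?thesis by simp
      qed simp
    qed
    also have "\<dots> = 2 * (1 / 4) ^ l * (card G / card A)"
      unfolding sum_distrib_left[symmetric] by (simp only: parseval[OF X G A])
    finally show ?thesis using l h0 by linarith
  qed
  \<comment> \<open>\<open>h\<close> is an average of translates of \<open>f\<close>: a bound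
    \<open>card V / 2\<close> for all coset sums of \<open>f\<close> would pass to \<open>h\<close>,
    contradicting \<open>close\<close>.\<close>
  have "\<exists>y\<in>G. (\<Sum>v\<in>V. f (v + y)) > card V / 2"
  proof (rule ccontr)
    assume "\<not> ?thesis"
    then have "(\<Sum>v\<in>V. f (v + y)) \<le> card V / 2" if "y \<in> G" for y using that by force
    then have "(\<Sum>v\<in>V. h (v + y)) \<le> card V / 2" if "y \<in> G" for y
      unfolding h_def g_def F_def
      by (intro coset_sum_shift_avg_le[OF G(2)] coset_sum_sym_avg_iter_le[OF G(2)] A fA B T T' that)
    from this[OF add_subgroup_zero[OF G(2)]] have "(\<Sum>v\<in>V. h v) \<le> card V / 2" by simp
    moreover have "card V * (3 / 4) \<le> (\<Sum>v\<in>V. h v)" using sum_bounded_below[of V "3 / 4" h] close by simp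
    ultimately show False using cV by simp
  qed
  then obtain y where "(\<Sum>v\<in>V. f (v + y)) > card V / 2" by blast
  moreover have "(\<Sum>v\<in>V. f (v + y)) = card {v \<in> V. v + y \<in> D}"
    unfolding f_def card_filter_sum[OF fV] of_nat_sum by simp
  ultimately have "2 * card {v \<in> V. v + y \<in> D} > card V" by linarith
  from subgroup_subset_difference[OF V(1) fV this] have VD: "V \<subseteq> D + uminus ` D" .
  have "uminus ` D = D" by (simp add: D_def B_def uminus_image_plus image_image add.commute)
  then have "V \<subseteq> (A + uminus ` A) + (A + uminus ` A)" using VD by (simp add: D_def B_def)
  moreover have "d \<le> 16 * (k * ln (card G / card A) + ln 2)"
  proof -
    have "card G / card T \<le> card G / ((card A / card G) ^ k / 2 * card G)"
      using T(2) Tpos cT by (intro divide_left_mono) auto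
    also have "\<dots> = 2 * (card G / card A) ^ k" using cA cG by (simp add: field_simps)
    finally have "ln (card G / card T) \<le> ln (2 * (card G / card A) ^ k)"
      using cT cG cA by (subst ln_le_cancel_iff) auto
    also have "\<dots> = k * ln (card G / card A) + ln 2"
      using cA cG by (simp add: ln_mult ln_realpow)
    finally show ?thesis by (intro order_trans[OF d] mult_left_mono) auto
  qed
  ultimately show ?thesis using that V by blast
qed

section \<open>Sets of small doubling\<close>

text \<open>Choice of parameters: \<open>l\<close> of order \<open>L\<close>, \<open>e\<close> of
  order \<open>1 / L\<close>, and \<open>k\<close> of order \<open>L / e\<^sup>2\<close>, hence
  \<open>L ^ 3\<close>. The codimension is of order \<open>k * L\<close>, which gives the fourth
  power.\<close>

theorem bogolyubov_dense_log:
  fixes G A :: "'g::ab_group_add set" and L :: real and p :: nat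
  assumes G: "finite G" "add_subgroup G" and A: "A \<subseteq> G" "A \<noteq> {}"
    and X: "dual_system p G X" and p: "p > 0" and L: "L \<ge> 1" "card G \<le> exp L * card A"
  obtains V d where "add_subgroup V" "V \<subseteq> G" "V \<subseteq> (A + uminus ` A) + (A + uminus ` A)"
    "card G \<le> p ^ d * card V" "d \<le> 10 ^ 9 * L ^ 4"
proof -
  have fA: "finite A" using A G finite_subset by blast
  have cA: "card A > 0" using fA A by (simp add: card_gt_0_iff)
  have cG: "card G \<ge> card A" using A G by (intro card_mono) auto
  have ratio: "card G / card A \<le> exp L" using cA L by (simp add: divide_simps)
  \<comment> \<open>The \<open>2\<close> extra averagings yield the factor \<open>1 / 16\<close>
    that turns the tail \<open>2 * exp (- L) * exp L\<close> into \<open>1 / 8\<close>.\<close>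
  define l where "l = nat \<lceil>L\<rceil> + 2"
  have l: "real l \<ge> L + 2" "real l \<le> 4 * L" using L unfolding l_def by linarith+
  \<comment> \<open>Makes \<open>4 * e * l\<close> equal to \<open>1 / 8\<close>.\<close>
  define e where "e = 1 / (32 * real l)"
  have e: "0 < e" "e \<le> 1" using l L by (auto simp: e_def divide_simps)
  \<comment> \<open>The least \<open>k\<close> with
    \<open>e\<^sup>2 * k / 4 \<ge> ln (4 / e) + L\<close>, so that the sampling error becomes at
    most \<open>8 * (e / 4) * exp (- L)\<close>.\<close>
  define k where "k = nat \<lceil>4 / e\<^sup>2 * (ln (4 / e) + L)\<rceil>"
  have ln0: "ln (4 / e) \<ge> 0" using e by simp
  then have arg: "4 / e\<^sup>2 * (ln (4 / e) + L) > 0" using e L by (intro mult_pos_pos add_nonneg_pos) auto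
  then have k: "k > 0" "real k \<ge> 4 / e\<^sup>2 * (ln (4 / e) + L)"
    "real k \<le> 4 / e\<^sup>2 * (ln (4 / e) + L) + 1"
    unfolding k_def by linarith+
  have ek: "8 * exp (- e\<^sup>2 * k / 4) * card G \<le> 2 * e * card A"
  proof -
    have "e\<^sup>2 / 4 * (4 / e\<^sup>2 * (ln (4 / e) + L)) \<le> e\<^sup>2 / 4 * k" using k(2) by (intro mult_left_mono) auto
    then have "ln (4 / e) + L \<le> e\<^sup>2 * k / 4" using e by simp
    then have "- e\<^sup>2 * k / 4 \<le> - (ln (4 / e) + L)" by simp
    then have "exp (- e\<^sup>2 * k / 4) \<le> exp (- (ln (4 / e) + L))" by simp
    also have "\<dots> = exp (- ln (4 / e)) * exp (- L)" by (simp flip: exp_add)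
    also have "exp (- ln (4 / e)) = e / 4" using e by (simp add: exp_minus)
    finally have "8 * exp (- e\<^sup>2 * k / 4) * card G \<le> 8 * (e / 4 * exp (- L)) * (exp L * card A)"
      using L e by (intro mult_mono) auto
    also have "\<dots> = 2 * e * card A" by (simp add: exp_minus field_simps)
    finally show ?thesis .
  qed
  have el: "4 * e * l \<le> 1 / 8" using l L by (simp add: e_def)
  have l4: "2 * (1 / 4) ^ l * (card G / card A) \<le> 1 / 8"
  proof -
    have "(1 / 4 :: real) \<le> exp (- 1)" using exp_le by (simp add: exp_minus divide_simps)
    then have "(1 / 4 :: real) ^ nat \<lceil>L\<rceil> \<le> exp (- 1) ^ nat \<lceil>L\<rceil>" by (intro power_mono) auto
    also have "\<dots> = exp (- real (nat \<lceil>L\<rceil>))" by (simp add: exp_of_nat_mult[symmetric])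
    also have "\<dots> \<le> exp (- L)" by simp linarith
    finally have "2 * (1 / 4) ^ l * (card G / card A) \<le> 2 * (exp (- L) * (1 / 16)) * exp L"
      using ratio unfolding l_def power_add by (intro mult_mono) (auto simp: power2_eq_square)
    also have "\<dots> = 1 / 8" by (simp add: exp_minus)
    finally show ?thesis .
  qed
  obtain V d where V: "add_subgroup V" "V \<subseteq> G" "V \<subseteq> (A + uminus ` A) + (A + uminus ` A)"
    "card G \<le> p ^ d * card V" and d: "d \<le> 16 * (k * ln (card G / card A) + ln 2)"
    by (rule bogolyubov_dense[OF G A X p e k(1) ek el l4])
  have lnr: "ln (card G / card A) \<le> L"
    using ratio cA cG by (metis divide_pos_pos ln_exp ln_le_cancel_iff exp_gt_zero of_nat_0_less_iff order_less_le_trans)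
  have "1 / e = 32 * l" using l L by (simp add: e_def)
  then have e1: "1 / e \<le> 128 * L" using l by simp
  then have "(1 / e)\<^sup>2 \<le> (128 * L)\<^sup>2" using e by (intro power_mono) auto
  then have e2: "4 / e\<^sup>2 \<le> 65536 * L\<^sup>2" by (simp add: power_divide power_mult_distrib)
  \<comment> \<open>This crude bound is of order \<open>L\<close>, no larger than the
    \<open>L\<close> added to the logarithm up to a constant.\<close>
  have "ln (4 / e) \<le> 4 / e" using e ln_bound[of "4 / e"] by simp
  also have "\<dots> \<le> 512 * L" using e1 by simp
  finally have "ln (4 / e) + L \<le> 513 * L" by simp
  then have "4 / e\<^sup>2 * (ln (4 / e) + L) \<le> 65536 * L\<^sup>2 * (513 * L)"
    using e2 ln0 L by (intro mult_mono) auto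
  then have "real k \<le> 33619968 * L ^ 3 + 1"
    using k(3) by (simp add: power2_eq_square power3_eq_cube)
  moreover have "1 \<le> L ^ 3" using L by simp
  ultimately have kb: "real k \<le> 33619969 * L ^ 3" by linarith
  have "k * ln (card G / card A) \<le> 33619969 * L ^ 3 * L"
    using kb lnr L cA cG by (intro mult_mono) auto
  also have "\<dots> = 33619969 * L ^ 4" by (simp add: power4_eq_xxxx power3_eq_cube)
  finally have "k * ln (card G / card A) \<le> 33619969 * L ^ 4" .
  moreover have "ln 2 \<le> (1::real)" using ln_bound[of 2] ln_2_less_1 by simp
  moreover have "1 \<le> L ^ 4" using L by simp
  \<comment> \<open>The actual factor is \<open>16 * (33619969 + 1)\<close>, with
    \<open>33619968 = 65536 * 513\<close>; it is rounded up to \<open>10 ^ 9\<close>.\<close>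
  ultimately have "d \<le> 10 ^ 9 * L ^ 4" using d by simp
  with V that show ?thesis by blast
qed

section \<open>Dense models modulo a subgroup\<close>

lemma nmult_mem: "add_subgroup H \<Longrightarrow> x \<in> H \<Longrightarrow> nmult k x \<in> H"
  by (induction k) (auto intro: add_subgroup_closed)

text \<open>A subgroup meeting \<open>E\<close> only in \<open>0\<close> and maximal with this property is a good model:
  every \<open>x\<close> outside it becomes, modulo \<open>H\<close>, a multiple of an element of \<open>E\<close>.\<close>

lemma maximal_avoiding_subgroup:
  fixes G E :: "'g::ab_group_add set"
  assumes G: "finite G" "add_subgroup G" and p: "prime p" "\<forall>x\<in>G. nmult p x = 0"
    and E: "E \<subseteq> G" "0 \<in> E"
  obtains H where "add_subgroup H" "H \<subseteq> G" "E \<inter> H = {0}" "card G \<le> p * card E * card H"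
proof -
  define P where "P H \<longleftrightarrow> add_subgroup H \<and> H \<subseteq> G \<and> E \<inter> H = {0}" for H
  have fE: "finite E" using E G finite_subset by blast
  have "P {0}" using G E by (auto simp: P_def add_subgroup_def)
  moreover have "\<forall>H. P H \<longrightarrow> card H < Suc (card G)"
    using card_mono[OF G(1)] by (auto simp: P_def less_Suc_eq_le)
  ultimately obtain H where H: "P H" and max: "\<And>H'. P H' \<Longrightarrow> card H' \<le> card H"
    using ex_has_greatest_nat[of P "{0}" card] by blast
  have sH: "add_subgroup H" "H \<subseteq> G" "E \<inter> H = {0}" using H by (auto simp: P_def)
  have fH: "finite H" using sH G finite_subset by blast
  have cover: "G \<subseteq> (\<lambda>(c, e, h). nmult c e + h) ` ({..<p} \<times> E \<times> H)"
  proof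
    fix x assume x: "x \<in> G"
    show "x \<in> (\<lambda>(c, e, h). nmult c e + h) ` ({..<p} \<times> E \<times> H)"
    proof (cases "x \<in> H")
      case True
      then show ?thesis
        using E p prime_gt_0_nat by (intro image_eqI[of _ _ "(0, 0, x)"]) auto
    next
      case False
      \<comment> \<open>The subgroup generated by \<open>H\<close> and \<open>x\<close>; natural
        multiples include the negative ones because \<open>p\<close> annihilates
        \<open>x\<close>.\<close>
      define H' where "H' = (\<lambda>(h, j). h + nmult j x) ` (H \<times> UNIV)"
      have H'G: "H' \<subseteq> G" using sH x G by (auto simp: H'_def intro!: add_subgroup_add nmult_mem)
      have neg: "- nmult j x = nmult ((p - 1) * j) x" for j
      proof -
        have "nmult ((p - 1) * j) x + nmult j x = nmult (p * j) x"
          using p prime_gt_0_nat[of p] by (simp flip: nmult_add add: algebra_simps)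
        also have "\<dots> = 0" using p x nmult_mem[OF G(2) x] by (simp add: nmult_mult)
        finally show ?thesis by (simp add: eq_neg_iff_add_eq_0 add.commute minus_unique)
      qed
      have "add_subgroup H'"
        unfolding add_subgroup_def
      proof (intro conjI ballI)
        show "0 \<in> H'" using add_subgroup_zero[OF sH(1)]
          by (auto simp: H'_def intro!: image_eqI[of _ _ "(0, 0)"])
        fix y z assume "y \<in> H'" "z \<in> H'"
        then obtain h i h' j where *: "h \<in> H" "h' \<in> H" "y = h + nmult i x" "z = h' + nmult j x"
          by (auto simp: H'_def)
        have "y - z = (h - h') + (nmult i x + - nmult j x)" by (simp add: * algebra_simps)
        also have "\<dots> = (h - h') + nmult (i + (p - 1) * j) x" by (simp add: neg nmult_add)
        finally show "y - z \<in> H'" using * sH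
          by (auto simp: H'_def intro!: image_eqI[of _ _ "(h - h', i + (p - 1) * j)"] add_subgroup_diff)
      qed
      moreover have "H \<subset> H'"
      proof
        show "H \<subseteq> H'" by (auto simp: H'_def intro!: image_eqI[of _ _ "(_, 0)"])
        have "x \<in> H'" using add_subgroup_zero[OF sH(1)]
          by (auto simp: H'_def intro!: image_eqI[of _ _ "(0, 1)"])
        then show "H \<noteq> H'" using False by auto
      qed
      then have "card H' > card H" using H'G G finite_subset by (intro psubset_card_mono) auto
      ultimately have "E \<inter> H' \<noteq> {0}" using max[of H'] H'G by (auto simp: P_def)
      moreover have "0 \<in> E \<inter> H'" using E add_subgroup_zero[OF \<open>add_subgroup H'\<close>] by auto
      ultimately obtain e where "e \<in> E" "e \<in> H'" "e \<noteq> 0" by auto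
      then obtain h j where e: "e \<in> E" "e \<noteq> 0" "h \<in> H" "e = h + nmult j x" by (auto simp: H'_def)
      have "\<not> p dvd j"
      proof
        assume "p dvd j"
        then have "nmult j x = 0"
          using p x nmult_mem[OF G(2) x] by (auto simp: nmult_mult)
        then show False using e sH by auto
      qed
      then have "coprime p j" using p(1) by (simp add: prime_imp_coprime)
      then have "coprime j p" by (simp add: coprime_commute)
      \<comment> \<open>Inverting \<open>j\<close> modulo \<open>p\<close> solves
        \<open>e = h + nmult j x\<close> for \<open>x\<close>. Reducing the inverse to
        \<open>c' < p\<close> limits the multipliers to the \<open>p\<close> values counted in the
        bound.\<close>
      then obtain c where c: "[j * c = 1] (mod p)" using cong_solve_coprime_nat by auto
      define c' where "c' = c mod p"
      have "(c' * j) mod p = (c * j) mod p" by (simp add: c'_def mod_mult_left_eq)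
      also have "\<dots> = 1" using c p prime_gt_1_nat[of p] by (simp add: cong_def mult.commute)
      finally have "(c' * j) mod p = 1" .
      then have "c' * j = (c' * j) div p * p + 1" by (metis div_mult_mod_eq)
      then have "nmult (c' * j) x = nmult ((c' * j) div p * p + 1) x" by (rule arg_cong)
      also have "\<dots> = x" using p x by (simp add: nmult_add nmult_mult)
      finally have "nmult (c' * j) x = x" .
      then have "nmult c' e = nmult c' h + x" by (simp add: e(4) nmult_distrib flip: nmult_mult)
      then have "x = nmult c' e + - nmult c' h" by simp
      moreover have "- nmult c' h \<in> H" using e sH by (intro add_subgroup_uminus nmult_mem)
      moreover have "c' < p" using p prime_gt_0_nat by (simp add: c'_def)
      ultimately show ?thesis using e by (intro image_eqI[of _ _ "(c', e, - nmult c' h)"]) auto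
    qed
  qed
  have "finite ({..<p} \<times> E \<times> H)" using fE fH by simp
  then have "card G \<le> card ({..<p} \<times> E \<times> H)" using cover by (rule surj_card_le)
  then show ?thesis using that sH by (simp add: card_cartesian_product mult.assoc)
qed

lemma nmult_numeral: "nmult (numeral n) x = nmult (pred_numeral n) x + x"
  by (simp add: numeral_eq_Suc)

text \<open>An element of \<open>E\<close> lying in \<open>H\<close> is \<open>0\<close>, so
  relations between few elements of \<open>D\<close> that hold modulo \<open>H\<close> hold exactly.
  The dense case applied to \<open>A + H\<close> can therefore be brought back to
  \<open>A\<close>.\<close>

theorem bogolyubov_ruzsa:
  fixes G A :: "'g::ab_group_add set" and K :: real and p :: nat
  assumes G: "finite G" "add_subgroup G" and p: "prime p" "\<forall>x\<in>G. nmult p x = 0"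
    and X: "dual_system p G X" and A: "A \<subseteq> G" "A \<noteq> {}"
    and K: "K \<ge> 1" "card (A + uminus ` A) \<le> K * card A"
  obtains V where "add_subgroup V" "V \<subseteq> (A + uminus ` A) + (A + uminus ` A)"
    "card V \<ge> card A / p powr (10 ^ 9 * 12 ^ 4 * ln (K * p) ^ 4)"
proof -
  have fA: "finite A" using A G finite_subset by blast
  have cA: "card A > 0" using fA A by (simp add: card_gt_0_iff)
  have p2: "p \<ge> 2" using p prime_ge_2_nat by blast
  define D where "D = A + uminus ` A"
  have mD: "uminus ` D = D" by (simp add: D_def uminus_image_plus image_image add.commute)
  have DG: "D \<subseteq> G" using A G unfolding D_def
    by (auto elim!: set_plus_elim intro!: add_subgroup_diff)
  obtain a0 where "a0 \<in> A" using A by auto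
  then have D0: "0 \<in> D" unfolding D_def using set_plus_intro[of a0 A "- a0" "uminus ` A"] by auto
  have addG: "S + S' \<subseteq> G" if "S \<subseteq> G" "S' \<subseteq> G" for S S'
    using that G by (auto elim!: set_plus_elim intro!: add_subgroup_add)
  have add0: "0 \<in> S + S'" if "0 \<in> S" "0 \<in> S'" for S S' :: "'g set"
    using set_plus_intro[OF that] by simp
  \<comment> \<open>One copy of \<open>D + D\<close> for each of the three elements in the proof
    that \<open>V\<close> is closed under differences.\<close>
  define E where "E = (D + D) + (D + D) + (D + D)"
  have EG: "E \<subseteq> G" "0 \<in> E" unfolding E_def by (intro addG add0 DG D0)+
  have "E = nmult 6 D" by (simp add: E_def nmult_numeral add_ac)
  then have cE: "card E \<le> K ^ 12 * card A"
    using plunnecke[OF fA A(2) K(2), of 6] by (simp add: D_def)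
  have DE: "D \<subseteq> E"
  proof
    fix d assume "d \<in> D"
    then have "d + 0 + (0 + 0) + (0 + 0) \<in> E" unfolding E_def by (intro set_plus_intro D0)
    then show "d \<in> E" by simp
  qed
  obtain H where H: "add_subgroup H" "H \<subseteq> G" "E \<inter> H = {0}" "card G \<le> p * card E * card H"
    by (rule maximal_avoiding_subgroup[OF G p EG])
  have fH: "finite H" using H G finite_subset by blast
  have cH: "card H > 0" using add_subgroup_zero[OF H(1)] fH by (auto simp: card_gt_0_iff)
  define B where "B = A + H"
  have "a0 + 0 \<in> B" unfolding B_def by (intro set_plus_intro \<open>a0 \<in> A\<close> add_subgroup_zero H)
  then have B: "B \<subseteq> G" "B \<noteq> {}" using addG A H by (auto simp: B_def)
  \<comment> \<open>\<open>D \<subseteq> E\<close> meets \<open>H\<close> only in \<open>0\<close>,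
    so elements of \<open>A\<close> are distinct modulo \<open>H\<close> and \<open>card B\<close>
    is the full product.\<close>
  have "inj_on (\<lambda>(a, h). a + h) (A \<times> H)"
  proof (rule inj_onI, clarify)
    fix a h a' h' assume *: "a \<in> A" "h \<in> H" "a' \<in> A" "h' \<in> H" "a + h = a' + h'"
    have eq: "a - a' = h' - h" using *(5) by (simp add: algebra_simps)
    have "a - a' \<in> D" unfolding D_def using set_plus_intro[of a A "- a'" "uminus ` A"] * by simp
    moreover have "a - a' \<in> H" unfolding eq using * H by (intro add_subgroup_diff)
    ultimately have "a - a' = 0" using H(3) DE by blast
    then show "a = a' \<and> h = h'" using * by simp
  qed
  then have cB: "card B = card A * card H"
    by (simp add: B_def set_plus_image card_image card_cartesian_product)
  \<comment> \<open>Chosen so that \<open>exp L = (K * p) ^ 12\<close> dominates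
    \<open>p * K ^ 12\<close>, the bound on \<open>card G / card B\<close> from \<open>H(4)\<close>
    and \<open>cE\<close>.\<close>
  define L where "L = 12 * ln (K * p)"
  have Kp: "K * p \<ge> 2" using K p2 mult_mono[of 1 K 2 "real p"] by simp
  have "exp (1 / 12) \<le> (2::real)" using exp_le_quadratic[of "1 / 12"] by (simp add: power2_eq_square)
  then have "1 / 12 \<le> ln (K * p)" using Kp by (subst ln_ge_iff) auto
  then have L1: "L \<ge> 1" unfolding L_def by simp
  have eL: "exp L = (K * p) ^ 12"
    using Kp exp_of_nat_mult[of 12 "ln (K * p)"] by (simp add: L_def)
  have "real (card G) \<le> real p * card E * card H" using H(4) by (metis of_nat_le_iff of_nat_mult)
  also have "\<dots> \<le> real p * (K ^ 12 * card A) * card H"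
    using cE by (intro mult_right_mono mult_left_mono) auto
  also have "\<dots> = real p * K ^ 12 * card B" by (simp add: cB)
  also have "\<dots> \<le> exp L * card B"
  proof -
    have "real p ^ 1 \<le> real p ^ 12" using p2 by (intro power_increasing) auto
    then have "real p * K ^ 12 \<le> exp L"
      unfolding eL power_mult_distrib using K by (simp add: mult.commute mult_left_mono)
    then show ?thesis by (intro mult_right_mono) auto
  qed
  finally have GB: "card G \<le> exp L * card B" .
  obtain W d where W: "add_subgroup W" "W \<subseteq> G" "W \<subseteq> (B + uminus ` B) + (B + uminus ` B)"
    "card G \<le> p ^ d * card W" and d: "d \<le> 10 ^ 9 * L ^ 4"
    by (rule bogolyubov_dense_log[OF G B X _ L1 GB]) (use p2 in auto)
  have "x \<in> uminus ` H" if "x \<in> H" for x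
    using add_subgroup_uminus[OF H(1) that] by (intro image_eqI[of _ _ "- x"]) auto
  then have HH1: "uminus ` H = H" using add_subgroup_uminus[OF H(1)] by auto
  have "x \<in> H + H" if "x \<in> H" for x
    using set_plus_intro[OF that add_subgroup_zero[OF H(1)]] by simp
  then have HH2: "H + H = H" using add_subgroup_add[OF H(1)] by (auto elim!: set_plus_elim)
  have "(B + uminus ` B) + (B + uminus ` B) = (D + D) + ((H + H) + (H + H))"
    by (simp only: B_def D_def uminus_image_plus HH1 add_ac)
  then have WD: "W \<subseteq> (D + D) + H" using W(3) HH2 by simp
  \<comment> \<open>The projection of \<open>W\<close> along \<open>H\<close> into
    \<open>D + D\<close>.\<close>
  define V where "V = {u \<in> D + D. \<exists>h\<in>H. u + h \<in> W}"
  have "V \<subseteq> G" using addG[OF DG DG] by (auto simp: V_def)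
  then have fV: "finite V" using G(1) by (rule finite_subset)
  have "add_subgroup V"
    unfolding add_subgroup_def
  proof (intro conjI ballI)
    show "0 \<in> V" using add0[OF D0 D0] add_subgroup_zero[OF H(1)] add_subgroup_zero[OF W(1)]
      by (auto simp: V_def intro!: bexI[of _ 0])
    fix u u' assume "u \<in> V" "u' \<in> V"
    then obtain h h' where u: "u \<in> D + D" "u' \<in> D + D" "h \<in> H" "h' \<in> H" "u + h \<in> W" "u' + h' \<in> W"
      by (auto simp: V_def)
    have w: "(u - u') + (h - h') \<in> W"
      using add_subgroup_diff[OF W(1) u(5,6)] by (simp add: algebra_simps)
    then have "(u - u') + (h - h') \<in> (D + D) + H" using WD by blast
    then obtain z g where z: "(u - u') + (h - h') = z + g" "z \<in> D + D" "g \<in> H"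
      by (rule set_plus_elim)
    have neg: "- y \<in> D + D" if "y \<in> D + D" for y
      using imageI[OF that, of uminus] by (simp add: uminus_image_plus mD)
    \<comment> \<open>This element of \<open>E\<close> also lies in \<open>H\<close>, hence
      vanishes; so \<open>u - u'\<close> equals \<open>z\<close> and stays in
      \<open>D + D\<close>.\<close>
    have mE: "u + - u' + - z \<in> E" unfolding E_def using u z by (intro set_plus_intro neg)
    have eqg: "u + - u' + - z = g - (h - h')" using z(1) by (simp add: algebra_simps)
    have "g - (h - h') \<in> H" using u z H by (intro add_subgroup_diff)
    with mE have "u + - u' + - z \<in> E \<inter> H" unfolding eqg by (rule IntI)
    then have "u + - u' + - z = 0" unfolding H(3) by simp
    then have "u - u' = z" by simp
    then have "u - u' \<in> D + D" using z by simp
    moreover have "h - h' \<in> H" using u H by (intro add_subgroup_diff)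
    ultimately show "u - u' \<in> V" using w unfolding V_def by blast
  qed
  moreover have "V \<subseteq> (A + uminus ` A) + (A + uminus ` A)" by (auto simp: V_def D_def)
  moreover have "card V \<ge> card A / p powr (10 ^ 9 * 12 ^ 4 * ln (K * p) ^ 4)"
  proof -
    have "W \<subseteq> V + H"
    proof
      fix x assume x: "x \<in> W"
      then have "x \<in> (D + D) + H" using WD by blast
      then obtain u h where u: "x = u + h" "u \<in> D + D" "h \<in> H" by (rule set_plus_elim)
      then have "u \<in> V" using x by (auto simp: V_def)
      then show "x \<in> V + H" using u by (simp add: set_plus_intro)
    qed
    then have "card W \<le> card (V + H)" using fV fH by (intro card_mono finite_set_plus)
    also have "\<dots> \<le> card (V \<times> H)" unfolding set_plus_image using fV fH by (intro card_image_le) auto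
    finally have WV: "card W \<le> card V * card H" by (simp add: card_cartesian_product)
    \<comment> \<open>The factor \<open>card H\<close> occurs on both sides and cancels, so the size
      of \<open>H\<close> does not enter the bound.\<close>
    have "card A * card H \<le> card G" using cB card_mono[OF G(1) B(1)] by simp
    also have "\<dots> \<le> p ^ d * (card V * card H)" using W(4) mult_le_mono2[OF WV] by (rule order_trans)
    finally have "card A \<le> p ^ d * card V" using cH by simp
    then have "real (card A) \<le> real p ^ d * card V" by (metis of_nat_le_iff of_nat_mult of_nat_power)
    also have "real p ^ d = p powr d" using p2 by (simp add: powr_realpow)
    also have "\<dots> \<le> p powr (10 ^ 9 * 12 ^ 4 * ln (K * p) ^ 4)"
      using d p2 by (intro powr_mono) (auto simp: L_def power_mult_distrib)
    finally have "real (card A) \<le> p powr (10 ^ 9 * 12 ^ 4 * ln (K * p) ^ 4) * card V"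
      by (simp add: mult_right_mono)
    then show ?thesis using p2 by (simp add: divide_le_eq mult.commute)
  qed
  ultimately show ?thesis using that by blast
qed

section \<open>Embedding of coordinate spaces\<close>

text \<open>
  The results above are stated inside one type of class \<open>ab_group_add\<close>, while \<open>p\<close> and \<open>n\<close> vary, so
  all the groups \<open>F\<^sub>p\<^sup>n\<close> are embedded into \<open>nat \<Rightarrow> circle\<close>, where \<open>circle\<close> is the group of complex
  numbers of modulus \<open>1\<close> written additively.
\<close>

typedef circle = "{z::complex. norm z = 1}"
  morphisms of_circle to_circle
  by (rule exI[of _ 1]) simp

setup_lifting type_definition_circle

instantiation circle :: ab_group_add
begin

lift_definition zero_circle :: circle is 1 by simp
lift_definition plus_circle :: "circle \<Rightarrow> circle \<Rightarrow> circle" is "(*)" by (simp add: norm_mult)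
lift_definition uminus_circle :: "circle \<Rightarrow> circle" is inverse by (simp add: norm_inverse)
lift_definition minus_circle :: "circle \<Rightarrow> circle \<Rightarrow> circle" is "(/)" by (simp add: norm_divide)

instance
proof
  fix a b c :: circle
  show "a + b + c = a + (b + c)" by transfer (simp add: mult.assoc)
  show "a + b = b + a" by transfer (simp add: mult.commute)
  show "0 + a = a" by transfer simp
  show "- a + a = 0" by transfer (metis left_inverse norm_zero zero_neq_one)
  show "a - b = a + - b" by transfer (simp add: divide_inverse)
qed

end

lift_definition root_circle :: "nat \<Rightarrow> int \<Rightarrow> circle" is "\<lambda>p k. cis (2 * pi * of_int k / of_nat p)"
  by simp

lemma root_circle_0: "root_circle p 0 = 0"
  by transfer simp

lemma root_circle_add: "root_circle p (j + k) = root_circle p j + root_circle p k"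
  by transfer (simp add: cis_mult algebra_simps add_divide_distrib)

lemma root_circle_period:
  assumes "p > 0"
  shows "root_circle p (int p * k) = 0"
proof -
  have "2 * pi * real_of_int (int p * k) / real p = 2 * pi * real_of_int k"
    using assms by simp
  then have "cis (2 * pi * of_int (int p * k) / of_nat p) = cis (2 * pi * of_int k)"
    by (rule arg_cong)
  also have "\<dots> = 1" by (rule cis_multiple_2pi) simp
  finally show ?thesis by (simp only: of_circle_inject[symmetric] root_circle.rep_eq zero_circle.rep_eq)
qed

lemma root_circle_mod: "p > 0 \<Longrightarrow> root_circle p (k mod int p) = root_circle p k"
  using root_circle_add[of p "int p * (k div int p)" "k mod int p"] by (simp add: root_circle_period)

lemma of_circle_root_circle: "of_circle (root_circle p k) = cis (2 * pi * of_int k / of_nat p)"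
  by (rule root_circle.rep_eq)

lemma inj_root_circle:
  assumes "p > 0"
  shows "inj_on (root_circle p) {0..int p - 1}"
proof (rule inj_onI)
  fix j k assume jk: "j \<in> {0..int p - 1}" "k \<in> {0..int p - 1}" "root_circle p j = root_circle p k"
  have inj: "inj_on (\<lambda>k. cis (2 * pi * real k / real p)) {..<p}"
    using bij_betw_roots_unity[OF assms] by (rule bij_betw_imp_inj_on)
  have "cis (2 * pi * real (nat j) / p) = cis (2 * pi * real (nat k) / p)"
    using jk(1,2) arg_cong[OF jk(3), of of_circle] by (simp add: of_circle_root_circle)
  moreover have "nat j \<in> {..<p}" "nat k \<in> {..<p}" using jk by auto
  ultimately have "nat j = nat k" by (rule inj_onD[OF inj])
  then show "j = k" using jk by auto
qed

lemma nmult_root_circle: "nmult c (root_circle p k) = root_circle p (int c * k)"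
  by (induction c) (simp_all add: root_circle_0 algebra_simps root_circle_add)

lemma nmult_fun_apply: "nmult c f i = nmult c (f i)"
  by (induction c) simp_all

section \<open>The embedded coordinate space and its characters\<close>

definition embed :: "nat \<Rightarrow> nat \<Rightarrow> (nat \<Rightarrow> int) \<Rightarrow> nat \<Rightarrow> circle" where
  "embed p n x = (\<lambda>i. if i < n then root_circle p (x i) else 0)"

lemma carrier_Fp_vec: "carrier (Fp_vec p n) = {..<n} \<rightarrow>\<^sub>E {0..int p - 1}"
  by (simp add: coord_module_def residue_ring_def)

lemma add_Fp_vec: "x \<oplus>\<^bsub>Fp_vec p n\<^esub> y = (\<lambda>i\<in>{..<n}. (x i + y i) mod int p)"
  and zero_Fp_vec: "\<zero>\<^bsub>Fp_vec p n\<^esub> = (\<lambda>i\<in>{..<n}. 0)"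
  and smult_Fp_vec: "c \<odot>\<^bsub>Fp_vec p n\<^esub> x = (\<lambda>i\<in>{..<n}. (c * x i) mod int p)"
  by (simp_all add: coord_module_def residue_ring_def)

lemma embed_zero: "embed p n \<zero>\<^bsub>Fp_vec p n\<^esub> = 0"
  by (auto simp: embed_def zero_Fp_vec root_circle_0)

lemma embed_add: "p > 0 \<Longrightarrow> embed p n (x \<oplus>\<^bsub>Fp_vec p n\<^esub> y) = embed p n x + embed p n y"
  by (auto simp: embed_def add_Fp_vec root_circle_mod root_circle_add)

text \<open>A scalar is represented by a number \<open>0 \<le> c < p\<close>, so scalar
  multiplication is repeated addition; hence subgroups of the image pull back to subspaces.\<close>

lemma embed_smult:
  assumes "p > 0" "c \<in> carrier (Fp p)"
  shows "embed p n (c \<odot>\<^bsub>Fp_vec p n\<^esub> x) = nmult (nat c) (embed p n x)"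
proof -
  have "c \<ge> 0" using assms(2) by (simp add: residue_ring_def)
  then show ?thesis using assms(1)
    by (auto simp: embed_def smult_Fp_vec root_circle_mod nmult_fun_apply nmult_root_circle)
qed

lemma inj_embed:
  assumes "p > 0"
  shows "inj_on (embed p n) (carrier (Fp_vec p n))"
proof (rule inj_onI)
  fix x y assume xy: "x \<in> carrier (Fp_vec p n)" "y \<in> carrier (Fp_vec p n)" "embed p n x = embed p n y"
  have "x i = y i" if "i < n" for i
  proof (rule inj_onD[OF inj_root_circle[OF assms]])
    show "root_circle p (x i) = root_circle p (y i)"
      using fun_cong[OF xy(3), of i] that by (simp add: embed_def)
    show "x i \<in> {0..int p - 1}" "y i \<in> {0..int p - 1}"
      using xy(1,2) that unfolding carrier_Fp_vec by (auto dest!: PiE_mem[where x = i])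
  qed
  then show "x = y" using xy(1,2) unfolding carrier_Fp_vec by (intro PiE_ext) auto
qed

text \<open>The character with frequency vector \<open>\<xi>\<close>. It is a monomial because the
  coordinates of an embedded vector are already roots of unity.\<close>

definition embed_char :: "nat \<Rightarrow> (nat \<Rightarrow> nat) \<Rightarrow> (nat \<Rightarrow> circle) \<Rightarrow> complex" where
  "embed_char n \<xi> y = (\<Prod>i<n. of_circle (y i) ^ \<xi> i)"

lemma norm_of_circle: "norm (of_circle z) = 1"
  using of_circle[of z] by simp

lemma character_embed_char: "character G (embed_char n \<xi>)"
  unfolding character_def
proof (intro conjI ballI)
  show "embed_char n \<xi> (x + y) = embed_char n \<xi> x * embed_char n \<xi> y" for x y
    by (simp add: embed_char_def plus_circle.rep_eq power_mult_distrib prod.distrib)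
  show "norm (embed_char n \<xi> x) = 1" for x
    by (simp add: embed_char_def norm_of_circle norm_power prod_norm[symmetric])
qed

lemma of_circle_root_circle_power: "p > 0 \<Longrightarrow> of_circle (root_circle p k) ^ p = 1"
  by (simp add: of_circle_root_circle DeMoivre)

text \<open>Evaluation at the element with \<open>root_circle p 1\<close> in place \<open>i\<close>
  and \<open>0\<close> elsewhere recovers \<open>\<xi> i\<close>. Injectivity allows sums over the
  characters to be indexed by exponent vectors.\<close>

lemma inj_embed_char:
  assumes "p > 0"
  shows "inj_on (embed_char n) ({..<n} \<rightarrow>\<^sub>E {..<p})"
proof (rule inj_onI)
  fix \<xi> \<eta> assume *: "\<xi> \<in> {..<n} \<rightarrow>\<^sub>E {..<p}" "\<eta> \<in> {..<n} \<rightarrow>\<^sub>E {..<p}" "embed_char n \<xi> = embed_char n \<eta>"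
  have inj: "inj_on (\<lambda>k. cis (2 * pi * real k / real p)) {..<p}"
    using bij_betw_roots_unity[OF assms] by (rule bij_betw_imp_inj_on)
  have "\<xi> i = \<eta> i" if i: "i \<in> {..<n}" for i
  proof (rule inj_onD[OF inj])
    define y where "y j = (if j = i then root_circle p 1 else 0)" for j
    have "embed_char n \<zeta> y = cis (2 * pi * real (\<zeta> i) / real p)" for \<zeta>
    proof -
      have "embed_char n \<zeta> y = (\<Prod>j<n. if j = i then of_circle (root_circle p 1) ^ \<zeta> i else 1)"
        unfolding embed_char_def by (intro prod.cong refl) (auto simp: y_def zero_circle.rep_eq)
      also have "\<dots> = of_circle (root_circle p 1) ^ \<zeta> i" using i by simp
      finally show ?thesis by (simp add: of_circle_root_circle DeMoivre mult_ac)
    qed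
    with fun_cong[OF *(3), of y]
    show "cis (2 * pi * real (\<xi> i) / real p) = cis (2 * pi * real (\<eta> i) / real p)" by simp
    show "\<xi> i \<in> {..<p}" "\<eta> i \<in> {..<p}" using * i by (auto dest: PiE_mem)
  qed
  then show "\<xi> = \<eta>" using *(1,2) by (intro PiE_ext) auto
qed

lemma card_embed:
  assumes "p > 0"
  shows "card (embed p n ` carrier (Fp_vec p n)) = p ^ n"
  using card_image[OF inj_embed[OF assms]] card_Fp_vec by simp

lemma sum_root_circle_powers:
  assumes "p > 0" "k \<in> {0..int p - 1}"
  shows "(\<Sum>j<p. of_circle (root_circle p k) ^ j) = (if k = 0 then of_nat p else 0)"
proof (cases "k = 0")
  case False
  have "of_circle (root_circle p k) \<noteq> 1"
  proof
    assume "of_circle (root_circle p k) = 1"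
    then have "root_circle p k = root_circle p 0"
      by (simp add: root_circle_0 of_circle_inject[symmetric] zero_circle.rep_eq)
    then show False using inj_onD[OF inj_root_circle[OF assms(1)]] assms False by auto
  qed
  then show ?thesis
    using False assms by (simp add: geometric_sum of_circle_root_circle_power)
qed (simp add: root_circle_0 zero_circle.rep_eq)

text \<open>The sum over exponent vectors factors into one geometric sum per coordinate, equal to
  \<open>p\<close> if the coordinate is zero and to \<open>0\<close> otherwise.\<close>

lemma dual_system_embed:
  assumes p: "p > 0"
  shows "dual_system p (embed p n ` carrier (Fp_vec p n)) (embed_char n ` ({..<n} \<rightarrow>\<^sub>E {..<p}))"
  unfolding dual_system_def
proof (intro conjI ballI)
  show "finite (embed_char n ` ({..<n} \<rightarrow>\<^sub>E {..<p}))" by (intro finite_imageI finite_PiE) auto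
next
  fix \<chi> assume \<chi>: "\<chi> \<in> embed_char n ` ({..<n} \<rightarrow>\<^sub>E {..<p})"
  then show "character (embed p n ` carrier (Fp_vec p n)) \<chi>" by (auto intro: character_embed_char)
  fix y assume "y \<in> embed p n ` carrier (Fp_vec p n)"
  then have "of_circle (y i) ^ p = 1" if "i < n" for i
    using that p by (auto simp: embed_def of_circle_root_circle_power)
  then have "(of_circle (y i) ^ m) ^ p = 1" if "i < n" for i m
    using that by (metis power_mult power_one mult.commute)
  then show "\<chi> y ^ p = 1" using \<chi> by (auto simp: embed_char_def prod_power_distrib)
next
  fix y assume "y \<in> embed p n ` carrier (Fp_vec p n)"
  then obtain x where x: "x \<in> carrier (Fp_vec p n)" "y = embed p n x" by auto
  have "(\<Sum>\<chi>\<in>embed_char n ` ({..<n} \<rightarrow>\<^sub>E {..<p}). \<chi> y) = (\<Sum>\<xi>\<in>{..<n} \<rightarrow>\<^sub>E {..<p}. embed_char n \<xi> y)"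
    by (subst sum.reindex[OF inj_embed_char[OF p]]) simp
  also have "\<dots> = (\<Prod>i<n. \<Sum>j<p. of_circle (y i) ^ j)"
    unfolding embed_char_def by (subst prod_sum_PiE) auto
  also have "\<dots> = (\<Prod>i<n. if x i = 0 then of_nat p else 0)"
  proof (intro prod.cong refl)
    fix i assume i: "i \<in> {..<n}"
    then have "x i \<in> {0..int p - 1}" using x(1) unfolding carrier_Fp_vec by (auto dest!: PiE_mem[where x = i])
    then show "(\<Sum>j<p. of_circle (y i) ^ j) = (if x i = 0 then of_nat p else 0)"
      using i p by (simp add: x(2) embed_def sum_root_circle_powers)
  qed
  also have "\<dots> = (if y = 0 then of_nat (card (embed p n ` carrier (Fp_vec p n))) else 0)"
  proof (cases "\<forall>i<n. x i = 0")
    case True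
    then have "y = 0" by (auto simp: x(2) embed_def root_circle_0)
    then show ?thesis using True by (simp add: card_embed[OF p])
  next
    case False
    then obtain i where i: "i < n" "x i \<noteq> 0" by auto
    have "\<zero>\<^bsub>Fp_vec p n\<^esub> \<in> carrier (Fp_vec p n)" using p by (auto simp: zero_Fp_vec carrier_Fp_vec)
    moreover have "x \<noteq> \<zero>\<^bsub>Fp_vec p n\<^esub>" using i by (auto simp: zero_Fp_vec)
    ultimately have "embed p n x \<noteq> embed p n \<zero>\<^bsub>Fp_vec p n\<^esub>"
      using inj_onD[OF inj_embed[OF p] _ x(1)] by blast
    then have "y \<noteq> 0" by (simp only: embed_zero x(2) not_False_eq_True)
    then show ?thesis using i by auto
  qed
  finally show "(\<Sum>\<chi>\<in>embed_char n ` ({..<n} \<rightarrow>\<^sub>E {..<p}). \<chi> y)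
      = (if y = 0 then of_nat (card (embed p n ` carrier (Fp_vec p n))) else 0)" .
qed

section \<open>Transfer of difference sets and subspaces\<close>

lemma embed_minus:
  assumes "prime p" "x \<in> carrier (Fp_vec p n)" "y \<in> carrier (Fp_vec p n)"
  shows "embed p n (x \<ominus>\<^bsub>Fp_vec p n\<^esub> y) = embed p n x - embed p n y"
proof -
  interpret M: module "Fp p" "Fp_vec p n" by (rule module_Fp_vec[OF assms(1)])
  have p: "p > 0" using assms(1) prime_gt_0_nat by blast
  have "embed p n (\<ominus>\<^bsub>Fp_vec p n\<^esub> y) + embed p n y = 0"
    using M.l_neg[OF assms(3)] by (simp add: embed_zero flip: embed_add[OF p])
  then show ?thesis
    unfolding a_minus_def embed_add[OF p] by (simp add: eq_neg_iff_add_eq_0[symmetric])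
qed

lemma embed_diff_set:
  assumes "prime p" "A \<subseteq> carrier (Fp_vec p n)"
  shows "embed p n ` diff_set (Fp_vec p n) A = embed p n ` A + uminus ` embed p n ` A"
proof -
  have "embed p n (a \<ominus>\<^bsub>Fp_vec p n\<^esub> b) = embed p n a + - embed p n b" if "a \<in> A" "b \<in> A" for a b
    using that assms by (subst embed_minus) auto
  then show ?thesis unfolding diff_set_def set_plus_def by (auto simp: image_iff) metis+
qed

lemma embed_double_diff_set:
  assumes "prime p" "A \<subseteq> carrier (Fp_vec p n)"
  shows "(embed p n ` A + uminus ` embed p n ` A) + (embed p n ` A + uminus ` embed p n ` A)
      \<subseteq> embed p n ` double_diff_set (Fp_vec p n) A"
proof
  interpret M: module "Fp p" "Fp_vec p n" by (rule module_Fp_vec[OF assms(1)])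
  have p: "p > 0" using assms(1) prime_gt_0_nat by blast
  fix y assume "y \<in> (embed p n ` A + uminus ` embed p n ` A) + (embed p n ` A + uminus ` embed p n ` A)"
  then obtain a b c d where *: "a \<in> A" "b \<in> A" "c \<in> A" "d \<in> A"
    "y = (embed p n a + - embed p n b) + (embed p n c + - embed p n d)"
    by (auto elim!: set_plus_elim)
  have car: "a \<in> carrier (Fp_vec p n)" "b \<in> carrier (Fp_vec p n)" "c \<in> carrier (Fp_vec p n)"
    "d \<in> carrier (Fp_vec p n)" using * assms by auto
  have "y = embed p n (((a \<oplus>\<^bsub>Fp_vec p n\<^esub> c) \<ominus>\<^bsub>Fp_vec p n\<^esub> b) \<ominus>\<^bsub>Fp_vec p n\<^esub> d)"
    using car by (simp add: *(5) embed_minus[OF assms(1)] embed_add[OF p] algebra_simps)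
  moreover have "((a \<oplus>\<^bsub>Fp_vec p n\<^esub> c) \<ominus>\<^bsub>Fp_vec p n\<^esub> b) \<ominus>\<^bsub>Fp_vec p n\<^esub> d \<in> double_diff_set (Fp_vec p n) A"
    using * unfolding double_diff_set_def by blast
  ultimately show "y \<in> embed p n ` double_diff_set (Fp_vec p n) A" by (rule image_eqI)
qed

text \<open>The subgroup found in the image of \<open>embed\<close> is pulled back along this
  injective homomorphism. In the constant, \<open>10 ^ 9\<close> comes from the dense case and
  \<open>12 ^ 4\<close> from the fourth power of \<open>12 * ln (K * p)\<close>.\<close>

theorem theorem8:
  shows "\<exists>C::real. C > 0 \<and>
    (\<forall>(p::nat) (n::nat) (K::real) (A::(nat \<Rightarrow> int) set).
       prime p \<longrightarrow> n > 0 \<longrightarrow> K \<ge> 1 \<longrightarrow>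
       A \<subseteq> carrier (Fp_vec p n) \<longrightarrow> A \<noteq> {} \<longrightarrow>
       real (card (diff_set (Fp_vec p n) A)) \<le> K * real (card A) \<longrightarrow>
       (\<exists>V. submodule V (Fp p) (Fp_vec p n) \<and>
            V \<subseteq> double_diff_set (Fp_vec p n) A \<and>
            real (card V) \<ge> real (card A) / real p powr (C * ln (K * real p) ^ 4)))"
proof (intro exI[of _ "10 ^ 9 * 12 ^ 4 :: real"] conjI allI impI)
  fix p n :: nat and K :: real and A :: "(nat \<Rightarrow> int) set"
  let ?M = "Fp_vec p n"
  assume pr: "prime p" and K: "K \<ge> 1" and A: "A \<subseteq> carrier ?M" "A \<noteq> {}"
    and small: "real (card (diff_set ?M A)) \<le> K * real (card A)"
  interpret M: module "Fp p" ?M by (rule module_Fp_vec[OF pr])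
  have p: "p > 0" using pr prime_gt_0_nat by blast
  define \<phi> where "\<phi> = embed p n"
  define G where "G = \<phi> ` carrier ?M"
  have inj: "inj_on \<phi> (carrier ?M)" unfolding \<phi>_def by (rule inj_embed[OF p])
  have DA: "diff_set ?M A \<subseteq> carrier ?M" "double_diff_set ?M A \<subseteq> carrier ?M"
    using A by (auto simp: diff_set_def double_diff_set_def intro!: M.minus_closed M.a_closed)
  have cA: "card (\<phi> ` A) = card A" using inj_on_subset[OF inj A(1)] by (rule card_image)
  have cD: "card (\<phi> ` A + uminus ` \<phi> ` A) = card (diff_set ?M A)"
    unfolding \<phi>_def embed_diff_set[OF pr A(1), symmetric]
    using inj_on_subset[OF inj DA(1)] unfolding \<phi>_def by (rule card_image)
  have G: "finite G" "add_subgroup G"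
  proof -
    show "finite G" unfolding G_def carrier_Fp_vec by (intro finite_imageI finite_PiE) auto
    show "add_subgroup G" unfolding add_subgroup_def
    proof (intro conjI ballI)
      show "0 \<in> G" unfolding G_def \<phi>_def using embed_zero[of p n] M.zero_closed by (metis imageI)
      fix x y assume "x \<in> G" "y \<in> G"
      then show "x - y \<in> G" unfolding G_def \<phi>_def
        by (auto simp flip: embed_minus[OF pr] intro!: imageI M.minus_closed)
    qed
  qed
  have tors: "\<forall>y\<in>G. nmult p y = 0"
    by (auto simp: G_def \<phi>_def embed_def fun_eq_iff nmult_fun_apply nmult_root_circle root_circle_period[OF p])
  have "\<phi> ` A \<subseteq> G" "\<phi> ` A \<noteq> {}" using A by (auto simp: G_def)
  moreover have "real (card (\<phi> ` A + uminus ` \<phi> ` A)) \<le> K * card (\<phi> ` A)"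
    using small by (simp add: cA cD)
  ultimately obtain W where W: "add_subgroup W"
    "W \<subseteq> (\<phi> ` A + uminus ` \<phi> ` A) + (\<phi> ` A + uminus ` \<phi> ` A)"
    "card W \<ge> card (\<phi> ` A) / p powr (10 ^ 9 * 12 ^ 4 * ln (K * p) ^ 4)"
    by (rule bogolyubov_ruzsa[OF G pr tors dual_system_embed[OF p, of n, folded \<phi>_def, folded G_def] _ _ K])
  have WD: "W \<subseteq> \<phi> ` double_diff_set ?M A"
    using W(2) embed_double_diff_set[OF pr A(1)] unfolding \<phi>_def by (rule order_trans)
  define V where "V = {x \<in> carrier ?M. \<phi> x \<in> W}"
  have "V \<subseteq> double_diff_set ?M A"
  proof
    fix x assume x: "x \<in> V"
    then obtain z where "z \<in> double_diff_set ?M A" "\<phi> x = \<phi> z" using WD by (auto simp: V_def)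
    then show "x \<in> double_diff_set ?M A" using inj_onD[OF inj] DA(2) x by (auto simp: V_def)
  qed
  moreover have "submodule V (Fp p) ?M"
  proof (rule M.submoduleI)
    show "V \<subseteq> carrier ?M" by (auto simp: V_def)
    show "\<zero>\<^bsub>?M\<^esub> \<in> V" using add_subgroup_zero[OF W(1)] by (simp add: V_def \<phi>_def embed_zero)
    fix a assume a: "a \<in> V"
    have "\<phi> (\<ominus>\<^bsub>?M\<^esub> a) = \<phi> (\<zero>\<^bsub>?M\<^esub> \<ominus>\<^bsub>?M\<^esub> a)" using a by (simp add: V_def a_minus_def)
    also have "\<dots> = - \<phi> a" using a by (simp add: V_def \<phi>_def embed_minus[OF pr] embed_zero)
    finally show "\<ominus>\<^bsub>?M\<^esub> a \<in> V" using a add_subgroup_uminus[OF W(1)] by (auto simp: V_def)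
    show "a \<oplus>\<^bsub>?M\<^esub> b \<in> V" if "b \<in> V" for b
      using a that add_subgroup_add[OF W(1)] by (auto simp: V_def \<phi>_def embed_add[OF p])
    show "c \<odot>\<^bsub>?M\<^esub> a \<in> V" if "c \<in> carrier (Fp p)" for c
      using a that nmult_mem[OF W(1)] by (auto simp: V_def \<phi>_def embed_smult[OF p])
  qed
  moreover have "card V = card W"
  proof -
    have "\<phi> ` V = W" using WD DA(2) by (auto simp: V_def)
    moreover have "inj_on \<phi> V" using inj by (rule inj_on_subset) (auto simp: V_def)
    ultimately show ?thesis by (metis card_image)
  qed
  ultimately show "\<exists>V. submodule V (Fp p) ?M \<and> V \<subseteq> double_diff_set ?M A \<and>
      real (card V) \<ge> real (card A) / real p powr (10 ^ 9 * 12 ^ 4 * ln (K * real p) ^ 4)"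
    using W(3) cA by (intro exI[of _ V]) simp
qed simp

end
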